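(* Let $q\in\mathbb{C}\setminus\{0\}$ be not a root of $1$. The collection of generic $U_q(\mathfrak{sl}_2)$-symmetries on $\mathbb{C}_q[x^{\pm1},y^{\pm1}]$ contains an uncountable family of isomorphism classes of $U_q(\mathfrak{sl}_2)$-symmetries on $\mathbb{C}_q[x^{\pm1},y^{\pm1}]$.
   Context: $\mathbb{C}_q[x^{\pm1},y^{\pm1}]$ is the unital $\mathbb{C}$-algebra with generators $x,x^{-1},y,y^{-1}$ and relations $yx=qxy$, $xx^{-1}=x^{-1}x=yy^{-1}=y^{-1}y=\mathbf 1$. $U_q(\mathfrak{sl}_2)$ is the unital algebra with generators $\mathsf k,\mathsf k^{-1},\mathsf e,\mathsf f$ and relations $\mathsf k\mathsf k^{-1}=\mathsf k^{-1}\mathsf k=\mathbf 1$, $\mathsf{ke}=q^2\mathsf{ek}$, $\mathsf{kf}=q^{-2}\mathsf{fk}$, $\mathsf{ef}-\mathsf{fe}=\frac{\mathsf k-\mathsf k^{-1}}{q-q^{-1}}$, with Hopf structure $\Delta(\mathsf k)=\mathsf k\otimes\mathsf k$, $\Delta(\mathsf e)=\mathbf 1\otimes\mathsf e+\mathsf e\otimes\mathsf k$, $\Delta(\mathsf f)=\mathsf f\otimes\mathbf 1+\mathsf k^{-1}\otimes\mathsf f$, $\varepsilon(\mathsf k)=1$, $\varepsilon(\mathsf e)=\varepsilon(\mathsf f)=0$, $S(\mathsf k)=\mathsf k^{-1}$, $S(\mathsf e)=-\mathsf e\mathsf k^{-1}$, $S(\mathsf f)=-\mathsf{kf}$. A ($U_q(\mathfrak{sl}_2)$-)symmetry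 on $A=\mathbb{C}_q[x^{\pm1},y^{\pm1}]$ is an algebra homomorphism $\pi:U_q(\mathfrak{sl}_2)\to\operatorname{End}_{\mathbb C}A$ with $\pi(h)(ab)=\sum_{(h)}\pi(h_{(1)})(a)\pi(h_{(2)})(b)$ and $\pi(h)(\mathbf 1)=\varepsilon(h)\mathbf 1$. Symmetries $\pi_1,\pi_2$ are isomorphic if there is an algebra automorphism $\Psi$ of $A$ with $\Psi\pi_1(h)\Psi^{-1}=\pi_2(h)$ for all $h$. The generic symmetries are the following ones: for $\alpha,\beta\in\mathbb{C}\setminus\{0\}$ such that $\alpha^u\beta^v=q^2$ for some $u,v\in\mathbb{Z}$ and $\alpha^m\beta^n\neq1$ for all $(m,n)\in\mathbb{Z}^2\setminus\{(0,0)\}$, and for $a\in\mathbb{C}\setminus\{0\}$, $$\pi(\mathsf k)(x)=\alpha x,\qquad \pi(\mathsf k)(y)=\beta y,$$ $$\pi(\mathsf e)(x)=aq^{uv+3}\frac{1-\alpha q^v}{(1-q^2)^2}x^{u+1}y^v,\qquad \pi(\mathsf e)(y)=aq^{uv+3}\frac{q^u-\beta}{(1-q^2)^2}x^uy^{v+1},$$ $$\pi(\mathsf f)(x)=-\frac{\alpha^{-1}-q^{-v}}{a}x^{-u+1}y^{-v},\qquad \pi(\mathsf f)(y)=-\frac{\beta^{-1}q^{-u}-1}{a}x^{-u}y^{-v+1}.$$ (It is known that these formulas determine well-defined symmetries and that these are the only symmetries with such $\alpha,\beta$ for which $\pi(\mathsf k)(x)=\alpha x$, $\pi(\mathsf k)(y)=\beta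 y$.) *)

theory Defs
  imports
    Complex_Main
    "HOL-Library.Countable_Set"
    "HOL-Library.Poly_Mapping"
    "HOL-Library.Product_Plus"
    "HOL-Library.FuncSet"
    "HOL-Algebra.QuotRing"
    "HOL-Algebra.Module"
begin

section \<open>Algebras given by generators and relations\<close>

text \<open>
  The free monoid, written additively because the convolution product of
  \<open>'m \<Rightarrow>\<^sub>0 complex\<close> is the product of the monoid algebra of an additive monoid \<open>'m\<close>.
  Hence \<open>'g word \<Rightarrow>\<^sub>0 complex\<close> is the free unital complex algebra on \<open>'g\<close>.
\<close>

datatype 'g word = Word (letters: "'g list")

instantiation word :: (type) monoid_add
begin

definition zero_word :: "'g word" where
  "zero_word = Word []"

definition plus_word :: "'g word \<Rightarrow> 'g word \<Rightarrow> 'g word" where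
  "plus_word v w = Word (letters v @ letters w)"

instance
  by standard (simp_all add: zero_word_def plus_word_def)

end

type_synonym 'g free_alg = "'g word \<Rightarrow>\<^sub>0 complex"

definition scalar :: "complex \<Rightarrow> ('m::monoid_add \<Rightarrow>\<^sub>0 complex)" where
  "scalar c = Poly_Mapping.single 0 c"

definition gen :: "'g \<Rightarrow> 'g free_alg" where
  "gen g = Poly_Mapping.single (Word [g]) 1"

definition free_algebra :: "'g free_alg ring" where
  "free_algebra = \<lparr>carrier = UNIV, mult = (*), one = 1, zero = 0, add = (+)\<rparr>"

definition cls :: "'g free_alg set \<Rightarrow> 'g free_alg \<Rightarrow> 'g free_alg set" where
  "cls R p = (Idl\<^bsub>free_algebra\<^esub> R) +>\<^bsub>free_algebra\<^esub> p"

definition presented_algebra :: "'g free_alg set \<Rightarrow> (complex, 'g free_alg set) module" where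
  "presented_algebra R =
     (let Q = free_algebra Quot (Idl\<^bsub>free_algebra\<^esub> R)
      in ring.extend Q (module.fields (\<lambda>c a. cls R (scalar c) \<otimes>\<^bsub>Q\<^esub> a)))"

text \<open>
  The algebra homomorphism that sends the generator \<open>g\<close> to \<open>\<phi> g\<close> and the scalar \<open>c\<close>
  to \<open>\<eta> c\<close>.
\<close>

definition free_lift :: "(complex \<Rightarrow> 'r::ring_1) \<Rightarrow> ('g \<Rightarrow> 'r) \<Rightarrow> 'g free_alg \<Rightarrow> 'r" where
  "free_lift \<eta> \<phi> p =
     (\<Sum>w\<in>Poly_Mapping.keys p. \<eta> (Poly_Mapping.lookup p w) * prod_list (map \<phi> (letters w)))"


section \<open>Homomorphisms and endomorphisms\<close>

text \<open>
  All maps between carriers are extensional, so that equality of maps means equality on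
  the carrier.
\<close>

definition alg_hom :: "(complex, 'a) module \<Rightarrow> (complex, 'b) module \<Rightarrow> ('a \<Rightarrow> 'b) set" where
  "alg_hom A B =
     {h \<in> ring_hom A B. h \<in> extensional (carrier A) \<and>
        (\<forall>c. \<forall>a\<in>carrier A. h (c \<odot>\<^bsub>A\<^esub> a) = c \<odot>\<^bsub>B\<^esub> h a)}"

definition alg_aut :: "(complex, 'a) module \<Rightarrow> ('a \<Rightarrow> 'a) set" where
  "alg_aut A = {\<Psi> \<in> alg_hom A A. bij_betw \<Psi> (carrier A) (carrier A)}"

definition linear_endos :: "(complex, 'a) module \<Rightarrow> ('a \<Rightarrow> 'a) set" where
  "linear_endos A =
     {f \<in> carrier A \<rightarrow>\<^sub>E carrier A.
        (\<forall>a\<in>carrier A. \<forall>b\<in>carrier A. f (a \<oplus>\<^bsub>A\<^esub> b) = f a \<oplus>\<^bsub>A\<^esub> f b) \<and>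
        (\<forall>c. \<forall>a\<in>carrier A. f (c \<odot>\<^bsub>A\<^esub> a) = c \<odot>\<^bsub>A\<^esub> f a)}"

definition End_algebra :: "(complex, 'a) module \<Rightarrow> (complex, 'a \<Rightarrow> 'a) module" where
  "End_algebra A =
     \<lparr>carrier = linear_endos A,
      mult = compose (carrier A),
      one = (\<lambda>a\<in>carrier A. a),
      zero = (\<lambda>a\<in>carrier A. \<zero>\<^bsub>A\<^esub>),
      add = (\<lambda>f g. \<lambda>a\<in>carrier A. f a \<oplus>\<^bsub>A\<^esub> g a),
      smult = (\<lambda>c f. \<lambda>a\<in>carrier A. c \<odot>\<^bsub>A\<^esub> f a)\<rparr>"


section \<open>The algebra \<open>\<complex>\<^sub>q[x\<^sup>\<plusminus>\<^sup>1, y\<^sup>\<plusminus>\<^sup>1]\<close>\<close>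

datatype torus_gen = X | X' | Y | Y'

definition torus_relations :: "complex \<Rightarrow> torus_gen free_alg set" where
  "torus_relations q =
     {gen Y * gen X - scalar q * gen X * gen Y,
      gen X * gen X' - 1, gen X' * gen X - 1,
      gen Y * gen Y' - 1, gen Y' * gen Y - 1}"

definition torus :: "complex \<Rightarrow> (complex, torus_gen free_alg set) module" where
  "torus q = presented_algebra (torus_relations q)"

definition tx :: "complex \<Rightarrow> torus_gen free_alg set" where
  "tx q = cls (torus_relations q) (gen X)"

definition ty :: "complex \<Rightarrow> torus_gen free_alg set" where
  "ty q = cls (torus_relations q) (gen Y)"

definition torus_mon :: "complex \<Rightarrow> int \<Rightarrow> int \<Rightarrow> torus_gen free_alg set" where
  "torus_mon q m n = tx q [^]\<^bsub>torus q\<^esub> m \<otimes>\<^bsub>torus q\<^esub> ty q [^]\<^bsub>torus q\<^esub> n"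


section \<open>The Hopf algebra \<open>U\<^sub>q(sl\<^sub>2)\<close>\<close>

datatype uq_gen = K | K' | E | F

definition uq_relations :: "complex \<Rightarrow> uq_gen free_alg set" where
  "uq_relations q =
     {gen K * gen K' - 1, gen K' * gen K - 1,
      gen K * gen E - scalar (q ^ 2) * gen E * gen K,
      gen K * gen F - scalar (inverse (q ^ 2)) * gen F * gen K,
      gen E * gen F - gen F * gen E - scalar (1 / (q - inverse q)) * (gen K - gen K')}"

definition uq :: "complex \<Rightarrow> (complex, uq_gen free_alg set) module" where
  "uq q = presented_algebra (uq_relations q)"

definition ucls :: "complex \<Rightarrow> uq_gen free_alg \<Rightarrow> uq_gen free_alg set" where
  "ucls q p = cls (uq_relations q) p"

text \<open>
  The tensor square of a free algebra is the monoid algebra of pairs of words: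
  \<open>tens v w\<close> is the pure tensor of the words \<open>v\<close> and \<open>w\<close>, and the convolution product is
  the usual product of a tensor product of algebras.
\<close>

definition tens :: "'g word \<Rightarrow> 'g word \<Rightarrow> ('g word \<times> 'g word \<Rightarrow>\<^sub>0 complex)" where
  "tens v w = Poly_Mapping.single (v, w) 1"

text \<open>
  The comultiplication and the counit of \<open>U\<^sub>q(sl\<^sub>2)\<close> are given by lifts to the free algebra:
  if \<open>h\<close> represents an element of \<open>U\<^sub>q(sl\<^sub>2)\<close>, then \<open>\<Delta>\<close> of this element is the image of
  \<open>uq_comult h\<close>, i.e. the sum of \<open>lookup (uq_comult h) (v, w)\<close> times the tensor product of
  the classes of \<open>v\<close> and \<open>w\<close>, over the finitely many pairs \<open>(v, w)\<close> in
  \<open>keys (uq_comult h)\<close>. The values on \<open>K'\<close> are forced by those on \<open>K\<close>. The antipode does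
  not enter the notion of a symmetry.
\<close>

fun comult_gen :: "uq_gen \<Rightarrow> (uq_gen word \<times> uq_gen word \<Rightarrow>\<^sub>0 complex)" where
  "comult_gen K = tens (Word [K]) (Word [K])"
| "comult_gen K' = tens (Word [K']) (Word [K'])"
| "comult_gen E = tens 0 (Word [E]) + tens (Word [E]) (Word [K])"
| "comult_gen F = tens (Word [F]) 0 + tens (Word [K']) (Word [F])"

definition uq_comult :: "uq_gen free_alg \<Rightarrow> (uq_gen word \<times> uq_gen word \<Rightarrow>\<^sub>0 complex)" where
  "uq_comult = free_lift scalar comult_gen"

fun counit_gen :: "uq_gen \<Rightarrow> complex" where
  "counit_gen K = 1"
| "counit_gen K' = 1"
| "counit_gen E = 0"
| "counit_gen F = 0"

definition uq_counit :: "uq_gen free_alg \<Rightarrow> complex" where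
  "uq_counit = free_lift (\<lambda>c. c) counit_gen"


section \<open>Symmetries\<close>

type_synonym action =
  "uq_gen free_alg set \<Rightarrow> torus_gen free_alg set \<Rightarrow> torus_gen free_alg set"

definition symmetries :: "complex \<Rightarrow> action set" where
  "symmetries q =
     {\<pi> \<in> alg_hom (uq q) (End_algebra (torus q)).
        (\<forall>h. \<forall>a\<in>carrier (torus q). \<forall>b\<in>carrier (torus q).
           \<pi> (ucls q h) (a \<otimes>\<^bsub>torus q\<^esub> b) =
           (\<Oplus>\<^bsub>torus q\<^esub>vw\<in>Poly_Mapping.keys (uq_comult h).
              Poly_Mapping.lookup (uq_comult h) vw \<odot>\<^bsub>torus q\<^esub>
                (\<pi> (ucls q (Poly_Mapping.single (fst vw) 1)) a \<otimes>\<^bsub>torus q\<^esub>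
                 \<pi> (ucls q (Poly_Mapping.single (snd vw) 1)) b))) \<and>
        (\<forall>h. \<pi> (ucls q h) \<one>\<^bsub>torus q\<^esub> = uq_counit h \<odot>\<^bsub>torus q\<^esub> \<one>\<^bsub>torus q\<^esub>)}"

definition iso_symmetries :: "complex \<Rightarrow> (action \<times> action) set" where
  "iso_symmetries q =
     {(\<pi>\<^sub>1, \<pi>\<^sub>2). \<pi>\<^sub>1 \<in> symmetries q \<and> \<pi>\<^sub>2 \<in> symmetries q \<and>
        (\<exists>\<Psi>\<in>alg_aut (torus q). \<forall>h\<in>carrier (uq q). \<forall>a\<in>carrier (torus q).
           \<Psi> (\<pi>\<^sub>1 h (inv_into (carrier (torus q)) \<Psi> a)) = \<pi>\<^sub>2 h a)}"

definition generic_formulas ::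
  "complex \<Rightarrow> complex \<Rightarrow> complex \<Rightarrow> complex \<Rightarrow> int \<Rightarrow> int \<Rightarrow> action \<Rightarrow> bool" where
  "generic_formulas q \<alpha> \<beta> a u v \<pi> \<longleftrightarrow>
     \<pi> (ucls q (gen K)) (tx q) = \<alpha> \<odot>\<^bsub>torus q\<^esub> tx q \<and>
     \<pi> (ucls q (gen K)) (ty q) = \<beta> \<odot>\<^bsub>torus q\<^esub> ty q \<and>
     \<pi> (ucls q (gen E)) (tx q) =
       (a * q powi (u * v + 3) * ((1 - \<alpha> * q powi v) / (1 - q ^ 2) ^ 2))
         \<odot>\<^bsub>torus q\<^esub> torus_mon q (u + 1) v \<and>
     \<pi> (ucls q (gen E)) (ty q) =
       (a * q powi (u * v + 3) * ((q powi u - \<beta>) / (1 - q ^ 2) ^ 2))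
         \<odot>\<^bsub>torus q\<^esub> torus_mon q u (v + 1) \<and>
     \<pi> (ucls q (gen F)) (tx q) =
       (- ((inverse \<alpha> - q powi (- v)) / a))
         \<odot>\<^bsub>torus q\<^esub> torus_mon q (- u + 1) (- v) \<and>
     \<pi> (ucls q (gen F)) (ty q) =
       (- ((inverse \<beta> * q powi (- u) - 1) / a))
         \<odot>\<^bsub>torus q\<^esub> torus_mon q (- u) (- v + 1)"

definition generic_symmetries :: "complex \<Rightarrow> action set" where
  "generic_symmetries q =
     {\<pi> \<in> symmetries q. \<exists>\<alpha> \<beta> a. \<exists>u v :: int.
        \<alpha> \<noteq> 0 \<and> \<beta> \<noteq> 0 \<and> a \<noteq> 0 \<and>
        \<alpha> powi u * \<beta> powi v = q ^ 2 \<and>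
        (\<forall>m n :: int. (m, n) \<noteq> (0, 0) \<longrightarrow> \<alpha> powi m * \<beta> powi n \<noteq> 1) \<and>
        generic_formulas q \<alpha> \<beta> a u v \<pi>}"

end

theory Submission
  imports
    Defs
    "HOL-Library.Product_Lexorder"
    "HOL-Analysis.Continuum_Not_Denumerable"
begin

text \<open>
  Write \<open>A\<close> for the quantum torus. The generic symmetries have a description without coordinates:
  there is a unit \<open>w\<close> with \<open>k(w) = q\<^sup>2w\<close> such that

  \<open>e(a) = w k(a) - a w\<close>  and  \<open>f(a) = d (k\<inverse>(a) w\<inverse> - w\<inverse> a)\<close>  with  \<open>d = q\<^sup>3 / (1 - q\<^sup>2)\<^sup>2\<close>,

  where \<open>w\<close> is a multiple of \<open>x\<^sup>u y\<^sup>v\<close>. Such an \<open>e\<close> is a twisted inner derivation, so the product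
  rule is automatic, and the value of \<open>d\<close> is what the commutator \<open>ef - fe\<close> requires.

  Only the case \<open>w = x\<close>, \<open>k(x) = q\<^sup>2x\<close>, \<open>k(y) = \<beta>y\<close> is constructed. It gives one symmetry
  \<open>torus_action \<beta>\<close> for every nonzero \<open>\<beta>\<close> (\<open>torus_action_symmetry\<close>). Independence of \<open>q\<^sup>2\<close> and
  \<open>\<beta>\<close> excludes finitely many \<open>\<beta>\<close> for each nonzero pair of exponents, hence leaves uncountably many
  (\<open>uncountable_independent\<close>).

  To control the whole isomorphism class one needs the automorphisms of \<open>A\<close>. With respect to
  the lexicographic order of exponents, the extreme monomials of a product are the products of the
  extreme monomials, so a unit is a single monomial (\<open>right_invertible_single\<close>). An automorphism
  preserves units, so it permutes the monomials up to factors, through an additive bijection of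
  \<open>\<int>\<^sup>2\<close>. Conjugation by it keeps the shape of the formulas above: the new \<open>k\<close> is again
  diagonal, with eigenvalues \<open>q\<^sup>2\<^sup>m\<beta>\<^sup>n\<close>, and the new \<open>w\<close> is again a multiple of a monomial. Evaluating
  at \<open>x\<close> and \<open>y\<close> gives the generic formulas (\<open>generic_of_isomorphic\<close>).

  Finally, if \<open>\<beta>\<close> and \<open>\<beta>'\<close> give isomorphic symmetries, then \<open>\<beta>'\<close> is one of the countably many
  numbers \<open>q\<^sup>2\<^sup>m\<beta>\<^sup>n\<close> (\<open>isomorphic_weights\<close>). Thus the map from \<open>\<beta>\<close> to isomorphism classes has
  countable fibres on an uncountable set.
\<close>

section \<open>Additive induction and the universal property of the free algebra\<close>

text \<open>
  The maps below are additive in each argument. This rule reduces identities between them to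
  monomials, without any bookkeeping of supports.
\<close>

lemma poly_mapping_additive_induct [case_names zero single add]:
  assumes "P 0" "\<And>k c. P (Poly_Mapping.single k c)" "\<And>u v. P u \<Longrightarrow> P v \<Longrightarrow> P (u + v)"
  shows "P (p :: 'a \<Rightarrow>\<^sub>0 'b::comm_monoid_add)"
proof (induction p rule: Poly_Mapping.update_induct)
  case const
  show ?case by (rule assms)
next
  case (update p a b)
  have "Poly_Mapping.update a b p = p + Poly_Mapping.single a b"
    by (rule poly_mapping_eqI)
       (use update in \<open>auto simp: lookup_update lookup_add lookup_single when_def in_keys_iff\<close>)
  then show ?case using assms update by simp
qed

lemma scalar_single [simp]: "scalar c * Poly_Mapping.single k d = Poly_Mapping.single k (c * d)"
  by (simp add: scalar_def mult_single)

lemma single_scalar [simp]: "Poly_Mapping.single k d * scalar c = Poly_Mapping.single k (d * c)"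
  by (simp add: scalar_def mult_single)

lemma scalar_central: "scalar c * p = p * scalar c"
  by (induction p rule: poly_mapping_additive_induct) (simp_all add: algebra_simps)

lemma scalar_add: "scalar (c + d) = scalar c + scalar d"
  by (simp add: scalar_def single_add)

lemma scalar_mult: "scalar (c * d) = scalar c * scalar d"
  by (simp add: scalar_def mult_single)

lemma scalar_1 [simp]: "scalar 1 = 1"
  by (simp add: scalar_def)

lemma scalar_0 [simp]: "scalar 0 = 0"
  by (simp add: scalar_def)

lemma letters_plus [simp]: "letters (v + w) = letters v @ letters w"
  by (simp add: plus_word_def)

lemma letters_0 [simp]: "letters 0 = []"
  by (simp add: zero_word_def)

lemma word_Cons: "Word (g # gs) = Word [g] + Word gs"
  by (simp add: plus_word_def)

text \<open>
  Centrality of the scalars is what makes \<^const>\<open>free_lift\<close> multiplicative. The locale is used for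
  the operators on \<open>\<complex>[\<int>\<^sup>2]\<close>, for the codomain of the comultiplication and for that of the counit.
\<close>

locale central_scalars =
  fixes \<eta> :: "complex \<Rightarrow> 'r::ring_1"
  assumes \<eta>_add: "\<eta> (c + d) = \<eta> c + \<eta> d"
    and \<eta>_mult: "\<eta> (c * d) = \<eta> c * \<eta> d"
    and \<eta>_1: "\<eta> 1 = 1"
    and \<eta>_central: "\<eta> c * r = r * \<eta> c"
begin

lemma \<eta>_0: "\<eta> 0 = 0"
  using \<eta>_add[of 0 0] by simp

lemma free_lift_single:
  "free_lift \<eta> \<phi> (Poly_Mapping.single w c) = \<eta> c * prod_list (map \<phi> (letters w))"
  by (cases "c = 0") (simp_all add: free_lift_def \<eta>_0)

lemma free_lift_0 [simp]: "free_lift \<eta> \<phi> 0 = 0"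
  by (simp add: free_lift_def)

lemma free_lift_add: "free_lift \<eta> \<phi> (p + r) = free_lift \<eta> \<phi> p + free_lift \<eta> \<phi> r"
  unfolding free_lift_def
  by (rule setsum_keys_plus_distrib) (simp_all add: \<eta>_0 \<eta>_add distrib_right)

lemma free_lift_minus: "free_lift \<eta> \<phi> (- p) = - free_lift \<eta> \<phi> p"
  using free_lift_add[of \<phi> p "- p"] by (simp add: add_eq_0_iff)

lemma free_lift_diff: "free_lift \<eta> \<phi> (p - r) = free_lift \<eta> \<phi> p - free_lift \<eta> \<phi> r"
  using free_lift_add[of \<phi> p "- r"] by (simp add: free_lift_minus)

lemma free_lift_mult: "free_lift \<eta> \<phi> (p * r) = free_lift \<eta> \<phi> p * free_lift \<eta> \<phi> r"
proof (induction p rule: poly_mapping_additive_induct)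
  case (single v c)
  show ?case
  proof (induction r rule: poly_mapping_additive_induct)
    case (single w d)
    have "\<eta> c * (\<eta> d * (prod_list (map \<phi> (letters v)) * prod_list (map \<phi> (letters w))))
        = \<eta> c * prod_list (map \<phi> (letters v)) * (\<eta> d * prod_list (map \<phi> (letters w)))"
      by (metis \<eta>_central mult.assoc)
    then show ?case
      by (simp add: mult_single free_lift_single \<eta>_mult mult.assoc)
  qed (simp_all add: distrib_left free_lift_add)
qed (simp_all add: distrib_right free_lift_add)

lemma free_lift_scalar [simp]: "free_lift \<eta> \<phi> (scalar c) = \<eta> c"
  by (simp add: scalar_def free_lift_single)

lemma free_lift_1 [simp]: "free_lift \<eta> \<phi> 1 = 1"
  using free_lift_scalar[of \<phi> 1] by (simp add: \<eta>_1 del: free_lift_scalar)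

lemma free_lift_gen [simp]: "free_lift \<eta> \<phi> (gen g) = \<phi> g"
  by (simp add: gen_def free_lift_single \<eta>_1)

lemmas free_lift_simps = free_lift_add free_lift_minus free_lift_diff free_lift_mult

end

text \<open>
  Every element of the free algebra is reached from the scalars by adding and by multiplying
  by a generator from the left, which is how statements about representations are proved.
\<close>

lemma free_alg_induct [case_names scalar gen add]:
  assumes "\<And>c. P (scalar c)" "\<And>g p. P p \<Longrightarrow> P (gen g * p)" "\<And>u v. P u \<Longrightarrow> P v \<Longrightarrow> P (u + v)"
  shows "P (p :: 'g free_alg)"
proof (induction p rule: poly_mapping_additive_induct)
  case zero
  show ?case using assms(1)[of 0] by simp
next
  case (single w c)
  have "P (Poly_Mapping.single (Word gs) c)" for gs
  proof (induction gs)
    case Nil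
    then show ?case using assms(1)[of c] by (simp add: scalar_def zero_word_def)
  next
    case (Cons g gs)
    have "Poly_Mapping.single (Word (g # gs)) c = gen g * Poly_Mapping.single (Word gs) c"
      by (simp add: gen_def mult_single word_Cons[of g gs])
    then show ?case using assms(2)[OF Cons.IH] by simp
  qed
  then show ?case by (metis word.collapse)
next
  case (add u v)
  then show ?case by (rule assms(3))
qed

section \<open>Presented algebras\<close>

lemma free_algebra_simps [simp]:
  "carrier free_algebra = UNIV" "mult free_algebra = (*)" "one free_algebra = 1"
  "zero free_algebra = 0" "add free_algebra = (+)"
  by (simp_all add: free_algebra_def)

lemma ring_free_algebra: "ring (free_algebra :: 'g free_alg ring)"
proof (rule ringI)
  show "abelian_group (free_algebra :: 'g free_alg ring)"
  proof (rule abelian_groupI)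
    fix x :: "'g free_alg"
    show "\<exists>y\<in>carrier free_algebra. y \<oplus>\<^bsub>free_algebra\<^esub> x = \<zero>\<^bsub>free_algebra\<^esub>"
      by (intro bexI[of _ "- x"]) simp_all
  qed (simp_all add: add_ac)
  show "Group.monoid (free_algebra :: 'g free_alg ring)"
    by (rule Group.monoidI) (simp_all add: mult.assoc)
qed (simp_all add: algebra_simps)

lemma ideal_Idl: "ideal (Idl\<^bsub>free_algebra\<^esub> R) (free_algebra :: 'g free_alg ring)"
  by (rule ring.genideal_ideal[OF ring_free_algebra]) simp

lemma cls_alt: "cls R p = {i + p | i. i \<in> Idl\<^bsub>free_algebra\<^esub> R}"
  by (auto simp: cls_def a_r_coset_def r_coset_def)

lemma a_inv_free_algebra [simp]: "\<ominus>\<^bsub>free_algebra\<^esub> (p :: 'g free_alg) = - p"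
proof -
  interpret ring "free_algebra :: 'g free_alg ring" by (rule ring_free_algebra)
  show ?thesis by (rule minus_equality) simp_all
qed

context
  fixes R :: "'g free_alg set"
begin

interpretation ideal "Idl\<^bsub>free_algebra\<^esub> R" "free_algebra :: 'g free_alg ring"
  by (rule ideal_Idl)

text \<open>
  From here on, the elements of a presented algebra are handled through representatives in the
  free algebra.
\<close>

lemma cls_eq_iff: "cls R p = cls R r \<longleftrightarrow> p - r \<in> Idl\<^bsub>free_algebra\<^esub> R"
proof
  assume "cls R p = cls R r"
  moreover have "p \<in> cls R p"
    unfolding cls_def by (rule a_rcos_self) simp
  ultimately obtain i where "i \<in> Idl\<^bsub>free_algebra\<^esub> R" "p = i + r"
    by (auto simp: cls_alt)
  then show "p - r \<in> Idl\<^bsub>free_algebra\<^esub> R" by simp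
next
  assume "p - r \<in> Idl\<^bsub>free_algebra\<^esub> R"
  then have "p \<in> cls R r" by (force simp: cls_alt)
  then show "cls R p = cls R r"
    unfolding cls_def by (intro a_repr_independence[symmetric] a_subgroup) simp_all
qed

lemma presented_algebra_cls:
  shows carrier_presented_algebra: "carrier (presented_algebra R) = range (cls R)"
    and cls_mult: "cls R p \<otimes>\<^bsub>presented_algebra R\<^esub> cls R r = cls R (p * r)"
    and cls_add: "cls R p \<oplus>\<^bsub>presented_algebra R\<^esub> cls R r = cls R (p + r)"
    and cls_1: "\<one>\<^bsub>presented_algebra R\<^esub> = cls R 1"
    and cls_0: "\<zero>\<^bsub>presented_algebra R\<^esub> = cls R 0"
    and cls_smult: "c \<odot>\<^bsub>presented_algebra R\<^esub> cls R p = cls R (scalar c * p)"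
proof -
  note d = presented_algebra_def Let_def ring.defs module.defs FactRing_def cls_def
  show "carrier (presented_algebra R) = range (cls R)"
    by (auto simp: d A_RCOSETS_def' a_r_coset_def)
  show m: "cls R p \<otimes>\<^bsub>presented_algebra R\<^esub> cls R r = cls R (p * r)" for p r
    using rcoset_mult_add[of p r] by (simp add: d)
  show "cls R p \<oplus>\<^bsub>presented_algebra R\<^esub> cls R r = cls R (p + r)"
    using a_rcos_sum[of p r] by (simp add: d)
  show "\<one>\<^bsub>presented_algebra R\<^esub> = cls R 1"
    by (simp add: d)
  show "\<zero>\<^bsub>presented_algebra R\<^esub> = cls R 0"
    by (simp add: d cls_alt a_r_coset_def r_coset_def)
  show "c \<odot>\<^bsub>presented_algebra R\<^esub> cls R p = cls R (scalar c * p)"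
    using m[of "scalar c" p] by (simp add: d)
qed

end

lemma ring_presented_algebra: "ring (presented_algebra R)"
proof (rule ringI)
  note s = carrier_presented_algebra cls_mult cls_add cls_1 cls_0
  show "abelian_group (presented_algebra R)"
  proof (rule abelian_groupI)
    fix x assume "x \<in> carrier (presented_algebra R)"
    then obtain p where "x = cls R p" by (auto simp: s)
    then show "\<exists>y\<in>carrier (presented_algebra R). y \<oplus>\<^bsub>presented_algebra R\<^esub> x = \<zero>\<^bsub>presented_algebra R\<^esub>"
      by (intro bexI[of _ "cls R (- p)"]) (simp_all add: s)
  qed (auto simp: s add_ac)
  show "Group.monoid (presented_algebra R)"
    by (rule Group.monoidI) (auto simp: s mult.assoc)
qed (auto simp: carrier_presented_algebra cls_mult cls_add algebra_simps)

context central_scalars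
begin

text \<open>
  A representation factors through a presented algebra as soon as it kills the relations,
  because its kernel is an ideal.
\<close>

lemma ideal_kernel_free_lift: "ideal {p. free_lift \<eta> \<phi> p = 0} free_algebra"
  by (intro idealI ring_free_algebra, unfold subgroup_def)
     (auto simp: free_lift_simps a_inv_free_algebra[unfolded a_inv_def, simplified])

lemma free_lift_Idl:
  assumes "\<And>r. r \<in> R \<Longrightarrow> free_lift \<eta> \<phi> r = 0" "p \<in> Idl\<^bsub>free_algebra\<^esub> R"
  shows "free_lift \<eta> \<phi> p = 0"
  using ring.genideal_minimal[OF ring_free_algebra ideal_kernel_free_lift, of R \<phi>] assms by blast

lemma free_lift_cong:
  assumes "\<And>r. r \<in> R \<Longrightarrow> free_lift \<eta> \<phi> r = 0" "cls R p = cls R p'"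
  shows "free_lift \<eta> \<phi> p = free_lift \<eta> \<phi> p'"
  using free_lift_Idl[of R \<phi> "p - p'"] assms by (simp add: cls_eq_iff free_lift_diff)

end

section \<open>Operators on the group algebra of the lattice\<close>

type_synonym lattice_vec = "int \<times> int \<Rightarrow>\<^sub>0 complex"

text \<open>
  Linear operators on \<open>\<complex>[\<int>\<^sup>2]\<close>, as a type of class \<open>ring_1\<close>, are a common target of
  \<^const>\<open>free_lift\<close> for both presentations: left multiplications give a faithful
  representation of the quantum torus, and the symmetries are representations of \<open>U\<^sub>q(sl\<^sub>2)\<close>.
\<close>

typedef linop =
  "{f :: lattice_vec \<Rightarrow> lattice_vec.
      (\<forall>u v. f (u + v) = f u + f v) \<and> (\<forall>c v. f (scalar c * v) = scalar c * f v)}"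
  morphisms app Abs_linop
  by (intro exI[of _ "\<lambda>v. v"]) simp

setup_lifting type_definition_linop

instantiation linop :: ring_1
begin

lift_definition zero_linop :: linop is "\<lambda>v. 0" by simp
lift_definition one_linop :: linop is "\<lambda>v. v" by simp
lift_definition plus_linop :: "linop \<Rightarrow> linop \<Rightarrow> linop" is "\<lambda>f g v. f v + g v"
  by (simp add: algebra_simps)
lift_definition uminus_linop :: "linop \<Rightarrow> linop" is "\<lambda>f v. - f v"
  by simp
lift_definition minus_linop :: "linop \<Rightarrow> linop \<Rightarrow> linop" is "\<lambda>f g v. f v - g v"
  by (simp add: algebra_simps)
lift_definition times_linop :: "linop \<Rightarrow> linop \<Rightarrow> linop" is "\<lambda>f g v. f (g v)"
  by simp

instance
proof
  show "(0::linop) \<noteq> 1"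
    by transfer (metis zero_neq_one)
qed (transfer; simp add: fun_eq_iff algebra_simps)+

end

lemma app_add [simp]: "app f (u + v) = app f u + app f v"
  by transfer simp

lemma app_smult: "app f (scalar c * v) = scalar c * app f v"
  by transfer simp

lemma app_0 [simp]: "app f 0 = 0"
  using app_add[of f 0 0] by (simp del: app_add)

lemma app_linop [simp]:
  "app 0 v = 0" "app 1 v = v" "app (f + g) v = app f v + app g v" "app (- f) v = - app f v"
  "app (f - g) v = app f v - app g v" "app (f * g) v = app f (app g v)"
  by (transfer; simp)+

lift_definition lscal :: "complex \<Rightarrow> linop" is "\<lambda>c v. scalar c * v"
  by (simp add: distrib_left mult.left_commute)

lemmas app_lscal [simp] = lscal.rep_eq

lemma linop_eqI: "(\<And>v. app f v = app g v) \<Longrightarrow> f = g"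
  by transfer (simp add: fun_eq_iff)

interpretation lscal: central_scalars lscal
  by standard (auto intro!: linop_eqI simp: scalar_add scalar_mult distrib_right mult.assoc app_smult)

lemma single_as_scalar: "Poly_Mapping.single k (c :: complex) = scalar c * Poly_Mapping.single k 1"
  by simp

lemma linop_eq_singleI:
  assumes "\<And>i. app f (Poly_Mapping.single i 1) = app g (Poly_Mapping.single i 1)"
  shows "f = g"
proof (rule linop_eqI)
  fix v show "app f v = app g v"
  proof (induction v rule: poly_mapping_additive_induct)
    case (single i c)
    show ?case by (subst (1 2) single_as_scalar) (simp only: app_smult assms)
  qed simp_all
qed

text \<open>
  All generators of both algebras act on monomials by such a map: they move the exponent by \<open>s\<close>
  and multiply by a number that depends on the exponent.
\<close>

definition weighted_shift ::
    "int \<times> int \<Rightarrow> (int \<times> int \<Rightarrow> complex) \<Rightarrow> lattice_vec \<Rightarrow> lattice_vec" where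
  "weighted_shift s f v =
     (\<Sum>i\<in>Poly_Mapping.keys v. Poly_Mapping.single (i + s) (f i * Poly_Mapping.lookup v i))"

lemma weighted_shift_add: "weighted_shift s f (u + v) = weighted_shift s f u + weighted_shift s f v"
  unfolding weighted_shift_def
  by (rule setsum_keys_plus_distrib) (simp_all add: distrib_left single_add)

lemma weighted_shift_single:
  "weighted_shift s f (Poly_Mapping.single i c) = Poly_Mapping.single (i + s) (f i * c)"
  by (cases "c = 0") (simp_all add: weighted_shift_def)

lemma weighted_shift_smult: "weighted_shift s f (scalar c * v) = scalar c * weighted_shift s f v"
proof (induction v rule: poly_mapping_additive_induct)
  case zero
  show ?case by (simp add: weighted_shift_def)
next
  case (single i d)
  show ?case by (simp add: weighted_shift_single mult.left_commute)
next
  case (add u v)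
  then show ?case by (simp add: distrib_left weighted_shift_add)
qed

lift_definition wshift :: "int \<times> int \<Rightarrow> (int \<times> int \<Rightarrow> complex) \<Rightarrow> linop" is weighted_shift
  by (simp add: weighted_shift_add weighted_shift_smult)

lemma app_wshift_single [simp]:
  "app (wshift s f) (Poly_Mapping.single i c) = Poly_Mapping.single (i + s) (f i * c)"
  by (simp add: wshift.rep_eq weighted_shift_single)

text \<open>
  Monomials are compared by their exponents, so the unit is kept in the form of a monomial.
\<close>

declare single_one [simp del]

section \<open>The twisted group algebra of the lattice\<close>

text \<open>
  The product with \<open>x\<^sup>my\<^sup>n \<cdot> x\<^sup>ky\<^sup>l = q\<^sup>n\<^sup>k x\<^sup>m\<^sup>+\<^sup>ky\<^sup>n\<^sup>+\<^sup>l\<close>, where \<open>(m, n)\<close> stands for \<open>x\<^sup>my\<^sup>n\<close>.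
\<close>

definition star :: "complex \<Rightarrow> lattice_vec \<Rightarrow> lattice_vec \<Rightarrow> lattice_vec" where
  "star q v w = (\<Sum>i\<in>Poly_Mapping.keys v.
     scalar (Poly_Mapping.lookup v i) * app (wshift i (\<lambda>j. q powi (snd i * fst j))) w)"

lemma star_add_left [simp]: "star q (u + v) w = star q u w + star q v w"
  unfolding star_def by (rule setsum_keys_plus_distrib) (simp_all add: distrib_right scalar_add)

lemma star_add_right [simp]: "star q v (u + w) = star q v u + star q v w"
  unfolding star_def by (simp add: sum.distrib distrib_left)

lemma star_0 [simp]: "star q 0 v = 0" "star q v 0 = 0"
  by (simp_all add: star_def)

lemma star_single [simp]:
  "star q (Poly_Mapping.single i c) (Poly_Mapping.single j d) =
   Poly_Mapping.single (i + j) (c * d * q powi (snd i * fst j))"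
  by (cases "c = 0") (simp_all add: star_def add.commute mult_ac)

section \<open>The quantum torus is the twisted group algebra\<close>

text \<open>
  Left multiplication by the generators on the basis \<open>x\<^sup>my\<^sup>n\<close>.
\<close>

fun torus_op :: "complex \<Rightarrow> torus_gen \<Rightarrow> linop" where
  "torus_op q X = wshift (1, 0) (\<lambda>_. 1)"
| "torus_op q X' = wshift (-1, 0) (\<lambda>_. 1)"
| "torus_op q Y = wshift (0, 1) (\<lambda>i. q powi fst i)"
| "torus_op q Y' = wshift (0, -1) (\<lambda>i. q powi (- fst i))"

definition torus_rep :: "complex \<Rightarrow> torus_gen free_alg \<Rightarrow> linop" where
  "torus_rep q = free_lift lscal (torus_op q)"

text \<open>
  Applying the representation to the unit reads off the coefficients of the normal form. They
  depend only on the class modulo the relations, which shows that the monomials are linearly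
  independent; rewriting words with the relations shows that they span.
\<close>

definition coeffs :: "complex \<Rightarrow> torus_gen free_alg \<Rightarrow> lattice_vec" where
  "coeffs q p = app (torus_rep q p) (Poly_Mapping.single 0 1)"

definition gen_powi :: "torus_gen \<Rightarrow> torus_gen \<Rightarrow> int \<Rightarrow> torus_gen free_alg" where
  "gen_powi g g' m = (if m \<ge> 0 then gen g ^ nat m else gen g' ^ nat (- m))"

definition monomial_rep :: "int \<times> int \<Rightarrow> torus_gen free_alg" where
  "monomial_rep i = gen_powi X X' (fst i) * gen_powi Y Y' (snd i)"

definition normal_form :: "lattice_vec \<Rightarrow> torus_gen free_alg" where
  "normal_form v = (\<Sum>i\<in>Poly_Mapping.keys v. scalar (Poly_Mapping.lookup v i) * monomial_rep i)"

lemma normal_form_add [simp]: "normal_form (u + v) = normal_form u + normal_form v"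
  unfolding normal_form_def
  by (rule setsum_keys_plus_distrib) (simp_all add: distrib_right scalar_add)

lemma normal_form_single [simp]: "normal_form (Poly_Mapping.single i c) = scalar c * monomial_rep i"
  by (cases "c = 0") (simp_all add: normal_form_def)

lemma normal_form_smult: "normal_form (scalar c * v) = scalar c * normal_form v"
  by (induction v rule: poly_mapping_additive_induct)
     (simp_all add: normal_form_def[of 0] distrib_left scalar_mult mult.assoc)

lemma normal_form_0 [simp]: "normal_form 0 = 0"
  by (simp add: normal_form_def)

lemma cls_mult_cong:
  assumes "cls R a = cls R a'" "cls R b = cls R b'"
  shows "cls R (a * b) = cls R (a' * b')"
  by (metis assms cls_mult)

lemma cls_gen_powi_Suc:
  assumes "cls R (gen g * gen g') = cls R 1"
  shows "cls R (gen g * gen_powi g g' m) = cls R (gen_powi g g' (m + 1))"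
proof (cases "m \<ge> 0")
  case True
  then show ?thesis by (simp add: gen_powi_def nat_add_distrib)
next
  case False
  define k where "k = nat (- m) - 1"
  have k: "m = - int (Suc k)" using False by (simp add: k_def)
  have "cls R (gen g * gen g' * gen g' ^ k) = cls R (1 * gen g' ^ k)"
    by (intro cls_mult_cong assms refl)
  moreover have "gen_powi g g' m = gen g' * gen g' ^ k" "gen_powi g g' (m + 1) = gen g' ^ k"
    by (simp_all add: gen_powi_def k nat_add_distrib)
  ultimately show ?thesis by (simp add: mult.assoc)
qed

lemma cls_gen_powi_pred:
  assumes "cls R (gen g' * gen g) = cls R 1"
  shows "cls R (gen g' * gen_powi g g' m) = cls R (gen_powi g g' (m - 1))"
proof (cases "m \<le> 0")
  case True
  have "nat (1 - m) = Suc (nat (- m))" using True by simp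
  with True show ?thesis by (auto simp: gen_powi_def)
next
  case False
  define k where "k = nat m - 1"
  have k: "m = int (Suc k)" using False by (simp add: k_def)
  have "cls R (gen g' * gen g * gen g ^ k) = cls R (1 * gen g ^ k)"
    by (intro cls_mult_cong assms refl)
  moreover have "gen_powi g g' m = gen g * gen g ^ k" "gen_powi g g' (m - 1) = gen g ^ k"
    by (simp_all add: gen_powi_def k nat_add_distrib)
  ultimately show ?thesis by (simp add: mult.assoc)
qed

lemma scalar_left_commute: "p * (scalar c * r) = scalar c * (p * r)"
proof -
  have "p * (scalar c * r) = (p * scalar c) * r" by (simp only: mult.assoc)
  also have "p * scalar c = scalar c * p" by (rule scalar_central[symmetric])
  finally show ?thesis by (simp only: mult.assoc)
qed

text \<open>
  Commutation rules up to a scalar propagate to powers, to inverses and to the reversed order.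
  Together with \<open>yx = qxy\<close> this gives the rule for every pair of integral powers.
\<close>

lemma cls_commute_power:
  assumes "cls R (a * b) = cls R (scalar s * (b * a))"
  shows "cls R (a * b ^ k) = cls R (scalar (s ^ k) * (b ^ k * a))"
proof (induction k)
  case (Suc k)
  have "cls R (a * b ^ Suc k) = cls R ((a * b) * b ^ k)"
    by (simp add: mult.assoc)
  also have "\<dots> = cls R ((scalar s * b) * (a * b ^ k))"
    using cls_mult_cong[OF assms refl[of "cls R (b ^ k)"]] by (simp add: mult.assoc)
  also have "\<dots> = cls R ((scalar s * b) * (scalar (s ^ k) * (b ^ k * a)))"
    by (intro cls_mult_cong Suc refl)
  also have "(scalar s * b) * (scalar (s ^ k) * (b ^ k * a)) = scalar (s ^ Suc k) * (b ^ Suc k * a)"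
    by (simp add: scalar_mult mult.assoc scalar_left_commute[of b])
  finally show ?case .
qed simp

text \<open>If \<open>b\<close> is inverted by \<open>b'\<close>, then a commutation rule with \<open>b\<close> can be conjugated by \<open>b'\<close>.\<close>

lemma cls_commute_inverse:
  assumes "cls R (a * b) = cls R (scalar s * (b * a))" "s \<noteq> 0"
    and "cls R (b * b') = cls R 1" "cls R (b' * b) = cls R 1"
  shows "cls R (a * b') = cls R (scalar (inverse s) * (b' * a))"
proof -
  have "cls R (scalar (inverse s) * (b' * a)) = cls R ((scalar (inverse s) * (b' * a)) * 1)"
    by simp
  also have "\<dots> = cls R ((scalar (inverse s) * (b' * a)) * (b * b'))"
    by (intro cls_mult_cong assms(3)[symmetric] refl)
  also have "\<dots> = cls R ((scalar (inverse s) * b') * (a * b) * b')"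
    by (simp add: mult.assoc)
  also have "\<dots> = cls R ((scalar (inverse s) * b') * (scalar s * (b * a)) * b')"
    by (intro cls_mult_cong assms(1) refl)
  also have "(scalar (inverse s) * b') * (scalar s * (b * a)) * b'
      = (scalar (inverse s) * scalar s) * ((b' * b) * (a * b'))"
    by (simp add: mult.assoc scalar_left_commute[of a] scalar_left_commute[of b'] scalar_left_commute[of b])
  also have "\<dots> = (b' * b) * (a * b')"
    using \<open>s \<noteq> 0\<close> by (simp flip: scalar_mult)
  also have "cls R \<dots> = cls R (1 * (a * b'))"
    by (intro cls_mult_cong assms(4) refl)
  finally show ?thesis by simp
qed

lemma cls_commute_swap:
  assumes "cls R (a * b) = cls R (scalar s * (b * a))" "s \<noteq> 0"
  shows "cls R (b * a) = cls R (scalar (inverse s) * (a * b))"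
proof -
  have "cls R (scalar (inverse s) * (a * b)) = cls R (scalar (inverse s) * (scalar s * (b * a)))"
    by (intro cls_mult_cong assms(1) refl)
  also have "\<dots> = cls R (b * a)"
    using \<open>s \<noteq> 0\<close> by (simp flip: scalar_mult mult.assoc)
  finally show ?thesis by simp
qed

locale nonzero_parameter =
  fixes q :: complex
  assumes q_nonzero [simp]: "q \<noteq> 0"
begin

abbreviation tcls :: "torus_gen free_alg \<Rightarrow> torus_gen free_alg set" where
  "tcls \<equiv> cls (torus_relations q)"

lemma torus_rep_relations: "r \<in> torus_relations q \<Longrightarrow> torus_rep q r = 0"
  unfolding torus_relations_def torus_rep_def
  by (auto simp: lscal.free_lift_simps power_int_add power_int_minus mult_ac intro!: linop_eq_singleI)

lemma coeffs_cong: "tcls p = tcls r \<Longrightarrow> coeffs q p = coeffs q r"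
  unfolding coeffs_def torus_rep_def
  by (metis lscal.free_lift_cong torus_rep_relations torus_rep_def)

lemma torus_op_star: "app (torus_op q g) (star q u v) = star q (app (torus_op q g) u) v"
proof (induction u rule: poly_mapping_additive_induct)
  case (single i c)
  show ?case
  proof (induction v rule: poly_mapping_additive_induct)
    case (single j d)
    show ?case
      by (cases i; cases j; cases g)
         (simp_all add: power_int_add power_int_diff power_int_minus field_simps)
  qed simp_all
qed simp_all

text \<open>
  The representation is by left multiplication in the twisted group algebra. Hence
  \<^term>\<open>coeffs q\<close> is multiplicative.
\<close>

lemma torus_rep_eq_star: "app (torus_rep q p) v = star q (coeffs q p) v"
proof (induction p rule: free_alg_induct)
  case (scalar c)
  show ?case
    by (induction v rule: poly_mapping_additive_induct)
       (simp_all add: torus_rep_def coeffs_def distrib_left)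
next
  case (gen g p)
  then show ?case
    by (simp add: torus_rep_def coeffs_def lscal.free_lift_mult torus_op_star)
next
  case (add u v)
  then show ?case by (simp add: torus_rep_def coeffs_def lscal.free_lift_add)
qed

lemma coeffs_mult: "coeffs q (p * r) = star q (coeffs q p) (coeffs q r)"
  unfolding torus_rep_eq_star[symmetric] by (simp add: coeffs_def torus_rep_def lscal.free_lift_mult)

lemma coeffs_add: "coeffs q (p + r) = coeffs q p + coeffs q r"
  by (simp add: coeffs_def torus_rep_def lscal.free_lift_add)

lemma coeffs_scalar: "coeffs q (scalar c) = Poly_Mapping.single 0 c"
  by (simp add: coeffs_def torus_rep_def)

lemma coeffs_1: "coeffs q 1 = Poly_Mapping.single 0 1"
  using coeffs_scalar[of 1] by simp

lemma coeffs_smult: "coeffs q (scalar c * p) = scalar c * coeffs q p"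
  by (simp add: coeffs_def torus_rep_def lscal.free_lift_mult)

lemma coeffs_gen: "coeffs q (gen g) = app (torus_op q g) (Poly_Mapping.single 0 1)"
  by (simp add: coeffs_def torus_rep_def)

lemma coeffs_power:
  assumes "coeffs q p = Poly_Mapping.single i 1" "fst i = 0 \<or> snd i = 0"
  shows "coeffs q (p ^ n) = Poly_Mapping.single (int n * fst i, int n * snd i) 1"
proof (induction n)
  case 0
  show ?case by (simp add: zero_prod_def coeffs_1)
next
  case (Suc n)
  then show ?case using assms by (cases i) (auto simp: coeffs_mult algebra_simps)
qed

lemma coeffs_monomial_rep: "coeffs q (monomial_rep i) = Poly_Mapping.single i 1"
proof -
  have "coeffs q (gen_powi X X' m) = Poly_Mapping.single (m, 0) 1" for m
    using coeffs_power[of "gen X" "(1,0)" "nat m"] coeffs_power[of "gen X'" "(-1,0)" "nat (- m)"]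
    by (auto simp: gen_powi_def coeffs_gen coeffs_1)
  moreover have "coeffs q (gen_powi Y Y' m) = Poly_Mapping.single (0, m) 1" for m
    using coeffs_power[of "gen Y" "(0,1)" "nat m"] coeffs_power[of "gen Y'" "(0,-1)" "nat (- m)"]
    by (auto simp: gen_powi_def coeffs_gen coeffs_1)
  ultimately show ?thesis
    by (simp add: monomial_rep_def coeffs_mult)
qed

lemma coeffs_normal_form: "coeffs q (normal_form v) = v"
  by (induction v rule: poly_mapping_additive_induct)
     (simp_all add: coeffs_add coeffs_smult coeffs_monomial_rep coeffs_scalar[of 0, simplified])

lemma tcls_inverses:
  "tcls (gen X * gen X') = tcls 1" "tcls (gen X' * gen X) = tcls 1"
  "tcls (gen Y * gen Y') = tcls 1" "tcls (gen Y' * gen Y) = tcls 1"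
  unfolding cls_eq_iff
  by (rule subsetD[OF ring.genideal_self[OF ring_free_algebra]]; simp add: torus_relations_def)+

lemma tcls_commute: "tcls (gen Y * gen X) = tcls (scalar q * (gen X * gen Y))"
  unfolding cls_eq_iff mult.assoc[symmetric]
  by (rule subsetD[OF ring.genideal_self[OF ring_free_algebra]]; simp add: torus_relations_def)

lemma tcls_commute_all:
  "tcls (gen Y * gen X') = tcls (scalar (inverse q) * (gen X' * gen Y))"
  "tcls (gen Y' * gen X) = tcls (scalar (inverse q) * (gen X * gen Y'))"
  "tcls (gen Y' * gen X') = tcls (scalar q * (gen X' * gen Y'))"
proof -
  show 1: "tcls (gen Y * gen X') = tcls (scalar (inverse q) * (gen X' * gen Y))"
    by (rule cls_commute_inverse[OF tcls_commute _ tcls_inverses(1,2)]) simp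
  have "tcls (gen X * gen Y') = tcls (scalar (inverse (inverse q)) * (gen Y' * gen X))"
    by (rule cls_commute_inverse[OF cls_commute_swap[OF tcls_commute] _ tcls_inverses(3,4)]) simp_all
  from cls_commute_swap[OF this]
  show "tcls (gen Y' * gen X) = tcls (scalar (inverse q) * (gen X * gen Y'))"
    by simp
  from cls_commute_inverse[OF this _ tcls_inverses(1,2)]
  show "tcls (gen Y' * gen X') = tcls (scalar q * (gen X' * gen Y'))"
    by simp
qed

lemma tcls_commute_powi:
  "tcls (gen Y * gen_powi X X' m) = tcls (scalar (q powi m) * (gen_powi X X' m * gen Y))"
  "tcls (gen Y' * gen_powi X X' m) = tcls (scalar (q powi (- m)) * (gen_powi X X' m * gen Y'))"
  using cls_commute_power[OF tcls_commute, of "nat m"]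
    cls_commute_power[OF tcls_commute_all(1), of "nat (- m)"]
    cls_commute_power[OF tcls_commute_all(2), of "nat m"]
    cls_commute_power[OF tcls_commute_all(3), of "nat (- m)"]
  by (auto simp: gen_powi_def power_int_def)

lemma tcls_gen_monomial_rep:
  "tcls (gen g * monomial_rep i) = tcls (normal_form (app (torus_op q g) (Poly_Mapping.single i 1)))"
proof -
  obtain m n where i: "i = (m, n)" by (cases i)
  let ?x = "gen_powi X X'" and ?y = "gen_powi Y Y'"
  have X: "tcls (gen X * ?x m * ?y n) = tcls (?x (m + 1) * ?y n)"
    "tcls (gen X' * ?x m * ?y n) = tcls (?x (m - 1) * ?y n)"
    by (intro cls_mult_cong cls_gen_powi_Suc cls_gen_powi_pred tcls_inverses refl)+
  have "tcls (gen Y * ?x m * ?y n) = tcls ((scalar (q powi m) * (?x m * gen Y)) * ?y n)"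
    by (intro cls_mult_cong tcls_commute_powi refl)
  also have "(scalar (q powi m) * (?x m * gen Y)) * ?y n = scalar (q powi m) * ?x m * (gen Y * ?y n)"
    by (simp add: mult.assoc)
  also have "tcls \<dots> = tcls (scalar (q powi m) * ?x m * ?y (n + 1))"
    by (intro cls_mult_cong cls_gen_powi_Suc tcls_inverses refl)
  finally have Y: "tcls (gen Y * ?x m * ?y n) = tcls (scalar (q powi m) * ?x m * ?y (n + 1))" .
  have "tcls (gen Y' * ?x m * ?y n) = tcls ((scalar (q powi (- m)) * (?x m * gen Y')) * ?y n)"
    by (intro cls_mult_cong tcls_commute_powi refl)
  also have "(scalar (q powi (- m)) * (?x m * gen Y')) * ?y n
      = scalar (q powi (- m)) * ?x m * (gen Y' * ?y n)"
    by (simp add: mult.assoc)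
  also have "tcls \<dots> = tcls (scalar (q powi (- m)) * ?x m * ?y (n - 1))"
    by (intro cls_mult_cong cls_gen_powi_pred tcls_inverses refl)
  finally have Y': "tcls (gen Y' * ?x m * ?y n) = tcls (scalar (q powi (- m)) * ?x m * ?y (n - 1))" .
  show ?thesis
    using X Y Y' by (cases g) (simp_all add: i monomial_rep_def mult.assoc)
qed

text \<open>
  The span of the monomials is stable under left multiplication by generators, and the
  representation computes this multiplication. By induction every class has a normal form.
\<close>

lemma tcls_gen_normal_form:
  "tcls (gen g * normal_form v) = tcls (normal_form (app (torus_op q g) v))"
proof (induction v rule: poly_mapping_additive_induct)
  case (single i c)
  have "tcls (scalar c * (gen g * monomial_rep i))
      = tcls (scalar c * normal_form (app (torus_op q g) (Poly_Mapping.single i 1)))"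
    by (intro cls_mult_cong tcls_gen_monomial_rep refl)
  moreover have "app (torus_op q g) (Poly_Mapping.single i c)
      = scalar c * app (torus_op q g) (Poly_Mapping.single i 1)"
    unfolding app_smult[symmetric] by simp
  moreover have "gen g * normal_form (Poly_Mapping.single i c) = scalar c * (gen g * monomial_rep i)"
    by (simp only: normal_form_single scalar_left_commute[of "gen g"])
  ultimately show ?case by (simp only: normal_form_smult)
next
  case (add u v)
  then show ?case by (simp only: distrib_left app_add normal_form_add cls_add[symmetric])
qed simp

lemma tcls_normal_form_coeffs: "tcls (normal_form (coeffs q p)) = tcls p"
proof (induction p rule: free_alg_induct)
  case (scalar c)
  show ?case by (simp add: coeffs_scalar monomial_rep_def gen_powi_def)
next
  case (gen g p)
  have "tcls (gen g * p) = tcls (gen g * normal_form (coeffs q p))"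
    by (intro cls_mult_cong gen[symmetric] refl)
  also have "\<dots> = tcls (normal_form (coeffs q (gen g * p)))"
    by (simp add: tcls_gen_normal_form coeffs_def torus_rep_def lscal.free_lift_mult)
  finally show ?case by simp
next
  case (add u v)
  then show ?case by (simp only: coeffs_add normal_form_add cls_add[symmetric])
qed

text \<open>
  The resulting isomorphism from the twisted group algebra onto the quantum torus. Everything
  after this section uses the quantum torus only through it.
\<close>

definition elt :: "lattice_vec \<Rightarrow> torus_gen free_alg set" where
  "elt v = tcls (normal_form v)"

lemma tcls_eq_elt: "tcls p = elt (coeffs q p)"
  by (simp add: elt_def tcls_normal_form_coeffs)

lemma carrier_torus: "carrier (torus q) = range elt"
proof
  show "carrier (torus q) \<subseteq> range elt"
    unfolding torus_def carrier_presented_algebra by (auto simp: tcls_eq_elt)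
  show "range elt \<subseteq> carrier (torus q)"
    unfolding torus_def carrier_presented_algebra by (auto simp: elt_def)
qed

lemma elt_in_carrier [simp]: "elt v \<in> carrier (torus q)"
  by (simp add: carrier_torus)

lemma elt_eq_iff [simp]: "elt u = elt v \<longleftrightarrow> u = v"
  using coeffs_cong coeffs_normal_form unfolding elt_def by metis

lemma elt_simps [simp]:
  "elt u \<otimes>\<^bsub>torus q\<^esub> elt v = elt (star q u v)"
  "elt u \<oplus>\<^bsub>torus q\<^esub> elt v = elt (u + v)"
  "c \<odot>\<^bsub>torus q\<^esub> elt v = elt (scalar c * v)"
  unfolding elt_def torus_def cls_mult cls_add cls_smult
  unfolding tcls_eq_elt coeffs_add coeffs_smult unfolding coeffs_mult coeffs_normal_form
  by (rule refl)+

lemma torus_consts: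
  "\<one>\<^bsub>torus q\<^esub> = elt (Poly_Mapping.single 0 1)"
  "\<zero>\<^bsub>torus q\<^esub> = elt 0"
  "tx q = elt (Poly_Mapping.single (1, 0) 1)"
  "ty q = elt (Poly_Mapping.single (0, 1) 1)"
  unfolding torus_def tx_def ty_def cls_1 cls_0 tcls_eq_elt
  using coeffs_scalar[of 0] coeffs_scalar[of 1] by (simp_all add: coeffs_gen)

lemma ring_torus: "ring (torus q)"
  unfolding torus_def by (rule ring_presented_algebra)

lemma finsum_elt: "finite S \<Longrightarrow> finsum (torus q) (\<lambda>i. elt (f i)) S = elt (\<Sum>i\<in>S. f i)"
proof (induction S rule: finite_induct)
  case empty
  interpret ring "torus q" by (rule ring_torus)
  show ?case by (simp add: torus_consts)
next
  case (insert x S)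
  interpret ring "torus q" by (rule ring_torus)
  show ?case using insert by (subst finsum_insert) simp_all
qed

lemma elt_nat_pow:
  assumes "fst i = 0 \<or> snd i = 0"
  shows "elt (Poly_Mapping.single i 1) [^]\<^bsub>torus q\<^esub> (n::nat) =
    elt (Poly_Mapping.single (int n * fst i, int n * snd i) 1)"
proof (induction n)
  case 0
  show ?case by (simp add: torus_consts zero_prod_def)
next
  case (Suc n)
  then show ?case using assms by (cases i) (auto simp: algebra_simps)
qed

lemma elt_int_pow:
  assumes "fst i = 0 \<or> snd i = 0"
  shows "elt (Poly_Mapping.single i 1) [^]\<^bsub>torus q\<^esub> (n::int) =
    elt (Poly_Mapping.single (n * fst i, n * snd i) 1)"
proof -
  interpret ring "torus q" by (rule ring_torus)
  have inv: "inv\<^bsub>torus q\<^esub> (elt (Poly_Mapping.single j 1)) = elt (Poly_Mapping.single (- j) 1)"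
    if "fst j = 0 \<or> snd j = 0" for j
    by (rule inv_unique'[symmetric]) (use that in \<open>auto simp: torus_consts\<close>)
  show ?thesis
  proof (cases "n < 0")
    case True
    let ?j = "(int (nat (- n)) * fst i, int (nat (- n)) * snd i)"
    have "elt (Poly_Mapping.single i 1) [^]\<^bsub>torus q\<^esub> n = inv\<^bsub>torus q\<^esub> (elt (Poly_Mapping.single ?j 1))"
      unfolding int_pow_def2 elt_nat_pow[OF assms] using True by simp
    also have "\<dots> = elt (Poly_Mapping.single (- ?j) 1)"
      by (rule inv) (use assms in auto)
    also have "- ?j = (n * fst i, n * snd i)"
      using True by simp
    finally show ?thesis .
  next
    case False
    then show ?thesis
      unfolding int_pow_def2 elt_nat_pow[OF assms] by simp
  qed
qed

lemma torus_mon_elt: "torus_mon q m n = elt (Poly_Mapping.single (m, n) 1)"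
  using elt_int_pow[of "(1, 0)" m] elt_int_pow[of "(0, 1)" n]
  by (simp add: torus_mon_def torus_consts)

end

section \<open>Invertible elements are monomials\<close>

lemma lookup_star:
  "Poly_Mapping.lookup (star q v w) k =
    (\<Sum>i\<in>Poly_Mapping.keys v. \<Sum>j\<in>Poly_Mapping.keys w.
      if i + j = k then Poly_Mapping.lookup v i * Poly_Mapping.lookup w j * q powi (snd i * fst j) else 0)"
  by (simp add: star_def wshift.rep_eq weighted_shift_def lookup_sum sum_distrib_left lookup_single
      when_def mult_ac add.commute cong: if_cong)

text \<open>
  A monomial of a product cannot cancel if its exponent decomposes in only one way.
\<close>

lemma star_unique_sum:
  assumes "i \<in> Poly_Mapping.keys v" "j \<in> Poly_Mapping.keys w"
    and unique: "\<And>i' j'. i' \<in> Poly_Mapping.keys v \<Longrightarrow> j' \<in> Poly_Mapping.keys w \<Longrightarrow> i' + j' = i + j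
      \<Longrightarrow> i' = i \<and> j' = j"
    and "q \<noteq> 0"
  shows "i + j \<in> Poly_Mapping.keys (star q v w)"
proof -
  have "Poly_Mapping.lookup (star q v w) (i + j) =
    (\<Sum>i'\<in>Poly_Mapping.keys v. \<Sum>j'\<in>Poly_Mapping.keys w. if j' = j then if i' = i then
       Poly_Mapping.lookup v i' * Poly_Mapping.lookup w j' * q powi (snd i' * fst j') else 0 else 0)"
    unfolding lookup_star by (intro sum.cong refl) (use unique in auto)
  also have "\<dots> = Poly_Mapping.lookup v i * Poly_Mapping.lookup w j * q powi (snd i * fst j)"
    using assms(1,2) by (simp add: sum.delta)
  also have "\<dots> \<noteq> 0"
    using assms(1,2,4) by (simp add: in_keys_iff)
  finally show ?thesis by (simp add: in_keys_iff)
qed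

lemma lex_sum_eq:
  fixes i j i' j' :: "int \<times> int"
  assumes "i' \<le> i" "j' \<le> j" "i' + j' = i + j"
  shows "i' = i \<and> j' = j"
  using assms by (cases i; cases j; cases i'; cases j') auto

lemma lex_add_eq_0:
  fixes i j i' j' :: "int \<times> int"
  assumes "i' \<le> i" "j' \<le> j" "i' + j' = 0" "i + j = 0"
  shows "i' = i \<and> j' = j"
  using assms lex_sum_eq by metis

text \<open>
  The largest exponents of \<open>v\<close> and \<open>w\<close> in the lexicographic order decompose uniquely in the
  product, and so do the smallest ones. If the product is a constant, both sums vanish, which
  forces the largest and the smallest exponent of \<open>v\<close> to agree.
\<close>

lemma right_invertible_single:
  assumes "star q v w = Poly_Mapping.single 0 1" "q \<noteq> 0"
  obtains i c where "c \<noteq> 0" "v = Poly_Mapping.single i c"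
proof -
  let ?V = "Poly_Mapping.keys v" and ?W = "Poly_Mapping.keys w"
  have "Poly_Mapping.single (0 :: int \<times> int) (1 :: complex) \<noteq> 0"
    by (metis lookup_single_eq lookup_zero zero_neq_one)
  then have "v \<noteq> 0" "w \<noteq> 0"
    using assms(1) by auto
  then have ne: "?V \<noteq> {}" "?W \<noteq> {}"
    by (auto simp: poly_mapping_eq_iff[of _ 0] fun_eq_iff in_keys_iff)
  have keys: "Poly_Mapping.keys (star q v w) = {0}"
    by (simp add: assms(1))
  have "Max ?V + Max ?W \<in> Poly_Mapping.keys (star q v w)"
    using ne assms(2) by (intro star_unique_sum lex_sum_eq) simp_all
  then have "Max ?V + Max ?W = 0"
    unfolding keys by simp
  moreover have "Min ?V + Min ?W \<in> Poly_Mapping.keys (star q v w)"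
  proof (rule star_unique_sum)
    fix i j assume "i \<in> ?V" "j \<in> ?W" "i + j = Min ?V + Min ?W"
    then have "Min ?V = i \<and> Min ?W = j"
      by (intro lex_sum_eq) simp_all
    then show "i = Min ?V \<and> j = Min ?W" by simp
  qed (use ne assms(2) in simp_all)
  then have "Min ?V + Min ?W = 0"
    unfolding keys by simp
  moreover have "Min ?V \<le> Max ?V" "Min ?W \<le> Max ?W"
    using ne by simp_all
  ultimately have MM: "Min ?V = Max ?V"
    using lex_add_eq_0 by blast
  have sub: "i = Max ?V" if "i \<in> ?V" for i
    using that MM by (metis Max_ge Min_le antisym finite_keys)
  define i where "i = Max ?V"
  have "v = Poly_Mapping.single i (Poly_Mapping.lookup v i)"
  proof (rule poly_mapping_eqI)
    fix k
    show "Poly_Mapping.lookup v k = Poly_Mapping.lookup (Poly_Mapping.single i (Poly_Mapping.lookup v i)) k"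
      using sub[of k] by (cases "k \<in> ?V") (auto simp only: in_keys_iff lookup_single when_def i_def split: if_splits)
  qed
  moreover have "Poly_Mapping.lookup v i \<noteq> 0"
    unfolding i_def using ne Max_in[of ?V] by (simp add: in_keys_iff)
  ultimately show ?thesis using that by blast
qed

section \<open>Symmetries with unit \<open>x\<close>\<close>

context nonzero_parameter
begin

text \<open>
  The eigenvalue of \<open>k\<close> on \<open>x\<^sup>my\<^sup>n\<close> when \<open>k(x) = q\<^sup>2x\<close> and \<open>k(y) = \<beta>y\<close>.
\<close>

definition weight :: "complex \<Rightarrow> int \<times> int \<Rightarrow> complex" where
  "weight \<beta> i = q powi (2 * fst i) * \<beta> powi snd i"

text \<open>
  The constant \<open>d\<close> for which \<open>ef - fe\<close> has the right normalisation.
\<close>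

definition f_coeff :: complex where
  "f_coeff = q ^ 3 / (1 - q ^ 2) ^ 2"

fun uq_op :: "complex \<Rightarrow> uq_gen \<Rightarrow> linop" where
  "uq_op \<beta> K = wshift 0 (weight \<beta>)"
| "uq_op \<beta> K' = wshift 0 (\<lambda>i. inverse (weight \<beta> i))"
| "uq_op \<beta> E = wshift (1, 0) (\<lambda>i. weight \<beta> i - q powi snd i)"
| "uq_op \<beta> F = wshift (-1, 0) (\<lambda>i. f_coeff * (inverse (weight \<beta> i) * q powi (- snd i) - 1))"

definition uq_rep :: "complex \<Rightarrow> uq_gen free_alg \<Rightarrow> linop" where
  "uq_rep \<beta> = free_lift lscal (uq_op \<beta>)"

text \<open>
  The coordinate-free form of \<open>e\<close> and, below, of \<open>f\<close>. It survives conjugation by an automorphism,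
  which the weights in \<^const>\<open>uq_op\<close> do not.
\<close>

lemma uq_op_E_eq:
  "app (uq_op \<beta> E) v =
     star q (Poly_Mapping.single (1, 0) 1) (app (uq_op \<beta> K) v) - star q v (Poly_Mapping.single (1, 0) 1)"
  by (induction v rule: poly_mapping_additive_induct)
     (simp_all add: single_diff[symmetric] algebra_simps)

lemma uq_op_F_eq:
  "app (uq_op \<beta> F) v = scalar f_coeff *
     (star q (app (uq_op \<beta> K') v) (Poly_Mapping.single (-1, 0) 1)
      - star q (Poly_Mapping.single (-1, 0) 1) v)"
proof (induction v rule: poly_mapping_additive_induct)
  case (single i c)
  have "i + (- 1, 0) = (- 1, 0) + i"
    by (rule add.commute)
  then show ?case
    by (simp add: single_diff[symmetric] scalar_def mult_single algebra_simps)
qed (simp_all add: algebra_simps)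

lemma weight_add:
  "\<beta> \<noteq> 0 \<Longrightarrow> weight \<beta> (i + j) = weight \<beta> i * weight \<beta> j"
  by (simp add: weight_def power_int_add distrib_left)

lemma power_int_diff_conv: "q powi (m - n) = q powi m * q powi (- n)"
  using power_int_add[of q m "- n"] by simp

lemma weight_nonzero [simp]: "\<beta> \<noteq> 0 \<Longrightarrow> weight \<beta> i \<noteq> 0"
  by (simp add: weight_def)

lemma weight_simps [simp]:
  "weight \<beta> (1, 0) = q\<^sup>2" "weight \<beta> (- 1, 0) = inverse (q\<^sup>2)" "weight \<beta> (0, 1) = \<beta>" "weight \<beta> 0 = 1"
  "weight \<beta> (0, 0) = 1"
  by (simp_all add: weight_def power_int_minus)

text \<open>
  On a monomial of weight \<open>\<lambda>\<close>, the terms of \<open>ef - fe\<close> other than multiples of \<open>\<lambda>\<close> and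
  \<open>\<lambda>\<inverse>\<close> cancel and \<open>d (1 - q\<^sup>-\<^sup>2) (\<lambda> - \<lambda>\<inverse>)\<close> remains, with
  \<open>d (1 - q\<^sup>-\<^sup>2) = 1 / (q - q\<inverse>)\<close>.
\<close>

lemma uq_rep_relations:
  assumes "\<beta> \<noteq> 0" "q\<^sup>2 \<noteq> 1" "r \<in> uq_relations q"
  shows "uq_rep \<beta> r = 0"
proof -
  let ?u = "uq_op \<beta>"
  have 1: "?u K * ?u K' = 1" "?u K' * ?u K = 1"
    by (auto intro!: linop_eq_singleI simp: assms(1))
  have 2: "?u K * ?u E = lscal (q\<^sup>2) * ?u E * ?u K"
    "?u K * ?u F = lscal (inverse (q\<^sup>2)) * ?u F * ?u K"
    by (rule linop_eq_singleI, simp add: weight_add[OF assms(1)] mult_ac)+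
  have "(?u E * ?u F - ?u F * ?u E) = lscal (1 / (q - inverse q)) * (?u K - ?u K')"
  proof (rule linop_eq_singleI)
    fix i
    have q: "q * q \<noteq> 1" "1 - q\<^sup>2 \<noteq> 0" "q - inverse q \<noteq> 0"
      using assms(2) by (auto simp: power2_eq_square field_simps)
    have d: "f_coeff * (1 - inverse (q\<^sup>2)) = 1 / (q - inverse q)"
      using q by (simp add: f_coeff_def divide_simps) (simp add: power2_eq_square power3_eq_cube algebra_simps)
    let ?w = "weight \<beta> i" and ?p = "q powi snd i"
    have "f_coeff * (inverse ?w * inverse ?p - 1) * (?w * inverse (q\<^sup>2) - ?p)
        - f_coeff * (inverse (?w * q\<^sup>2) * inverse ?p - 1) * (?w - ?p)
        = (f_coeff * (1 - inverse (q\<^sup>2))) * (?w - inverse ?w)"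
      using assms(1) by (simp add: field_simps)
    then show "app (?u E * ?u F - ?u F * ?u E) (Poly_Mapping.single i 1) =
        app (lscal (1 / (q - inverse q)) * (?u K - ?u K')) (Poly_Mapping.single i 1)"
      unfolding d
      by (simp add: single_diff[symmetric] weight_add[OF assms(1)] power_int_minus mult_ac
          add.assoc zero_prod_def[symmetric])
  qed
  with 1 2 show ?thesis
    using assms(3) unfolding uq_relations_def uq_rep_def
    by (auto simp: lscal.free_lift_simps)
qed

lemma uq_op_star:
  assumes "\<beta> \<noteq> 0"
  shows "app (uq_op \<beta> K) (star q u v) = star q (app (uq_op \<beta> K) u) (app (uq_op \<beta> K) v)"
    and "app (uq_op \<beta> K') (star q u v) = star q (app (uq_op \<beta> K') u) (app (uq_op \<beta> K') v)"
    and "app (uq_op \<beta> E) (star q u v) =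
      star q u (app (uq_op \<beta> E) v) + star q (app (uq_op \<beta> E) u) (app (uq_op \<beta> K) v)"
    and "app (uq_op \<beta> F) (star q u v) =
      star q (app (uq_op \<beta> F) u) v + star q (app (uq_op \<beta> K') u) (app (uq_op \<beta> F) v)"
proof -
  note a = poly_mapping_additive_induct
  show "app (uq_op \<beta> K) (star q u v) = star q (app (uq_op \<beta> K) u) (app (uq_op \<beta> K) v)"
  proof (induction u rule: a)
    case (single i c)
    show ?case
      by (induction v rule: a) (simp_all add: weight_add[OF assms] mult_ac)
  qed simp_all
  show "app (uq_op \<beta> K') (star q u v) = star q (app (uq_op \<beta> K') u) (app (uq_op \<beta> K') v)"
  proof (induction u rule: a)
    case (single i c)
    show ?case
      by (induction v rule: a) (simp_all add: weight_add[OF assms] mult_ac)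
  qed simp_all
  show "app (uq_op \<beta> E) (star q u v) =
      star q u (app (uq_op \<beta> E) v) + star q (app (uq_op \<beta> E) u) (app (uq_op \<beta> K) v)"
  proof (induction u rule: a)
    case (single i c)
    show ?case
    proof (induction v rule: a)
      case (single j d)
      show ?case
        by (cases i; cases j) (simp add: single_add[symmetric] weight_add[OF assms, of "(_, _)" "(_, _)", simplified]
            power_int_add field_simps)
    qed (simp_all add: algebra_simps)
  qed (simp_all add: algebra_simps)
  show "app (uq_op \<beta> F) (star q u v) =
      star q (app (uq_op \<beta> F) u) v + star q (app (uq_op \<beta> K') u) (app (uq_op \<beta> F) v)"
  proof (induction u rule: a)
    case (single i c)
    show ?case
    proof (induction v rule: a)
      case (single j d)
      show ?case
        by (cases i; cases j) (simp add: single_add[symmetric] weight_add[OF assms, of "(_, _)" "(_, _)", simplified]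
            power_int_add power_int_diff_conv algebra_simps)
    qed (simp_all add: algebra_simps)
  qed (simp_all add: algebra_simps)
qed

end

interpretation monoid_algebra: central_scalars "scalar :: complex \<Rightarrow> ('m::monoid_add \<Rightarrow>\<^sub>0 complex)"
  by standard (rule scalar_add scalar_mult scalar_1 scalar_central)+

interpretation numbers: central_scalars "\<lambda>c :: complex. c"
  by standard (simp_all add: mult.commute)

context nonzero_parameter
begin

text \<open>
  The right-hand side of the product rule for an arbitrary tensor \<open>t\<close> in place of the
  comultiplication. In this generality it is compatible with multiplication of tensors, and the
  product rule need only be known for generators.
\<close>

definition tensor_act ::
    "complex \<Rightarrow> (uq_gen word \<times> uq_gen word \<Rightarrow>\<^sub>0 complex) \<Rightarrow> lattice_vec \<Rightarrow> lattice_vec \<Rightarrow> lattice_vec" where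
  "tensor_act \<beta> t u v = (\<Sum>vw\<in>Poly_Mapping.keys t. scalar (Poly_Mapping.lookup t vw) *
     star q (app (uq_rep \<beta> (Poly_Mapping.single (fst vw) 1)) u)
            (app (uq_rep \<beta> (Poly_Mapping.single (snd vw) 1)) v))"

lemma tensor_act_add: "tensor_act \<beta> (s + t) u v = tensor_act \<beta> s u v + tensor_act \<beta> t u v"
  unfolding tensor_act_def
  by (rule setsum_keys_plus_distrib[where f = "\<lambda>vw c. scalar c *
        star q (app (uq_rep \<beta> (Poly_Mapping.single (fst vw) 1)) u)
               (app (uq_rep \<beta> (Poly_Mapping.single (snd vw) 1)) v)"])
     (simp_all only: scalar_add distrib_right scalar_0 mult_zero_left)

lemma tensor_act_single:
  "tensor_act \<beta> (Poly_Mapping.single vw c) u v = scalar c *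
     star q (app (uq_rep \<beta> (Poly_Mapping.single (fst vw) 1)) u)
            (app (uq_rep \<beta> (Poly_Mapping.single (snd vw) 1)) v)"
  by (cases "c = 0") (simp_all add: tensor_act_def)

lemma tensor_act_0 [simp]: "tensor_act \<beta> 0 u v = 0"
  by (simp add: tensor_act_def)

lemma uq_rep_word_add:
  "uq_rep \<beta> (Poly_Mapping.single (v + w) 1) =
   uq_rep \<beta> (Poly_Mapping.single v 1) * uq_rep \<beta> (Poly_Mapping.single w 1)"
  unfolding uq_rep_def lscal.free_lift_mult[symmetric] by (simp add: mult_single)

lemma uq_rep_words [simp]:
  "uq_rep \<beta> (Poly_Mapping.single 0 1) = 1"
  "uq_rep \<beta> (Poly_Mapping.single (Word [g]) 1) = uq_op \<beta> g"
  by (simp_all add: uq_rep_def lscal.free_lift_single lscal.\<eta>_1)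

lemma tensor_act_mult_single:
  "tensor_act \<beta> (s * Poly_Mapping.single (v, w) c) a b = scalar c *
     tensor_act \<beta> s (app (uq_rep \<beta> (Poly_Mapping.single v 1)) a)
                    (app (uq_rep \<beta> (Poly_Mapping.single w 1)) b)"
proof (induction s rule: poly_mapping_additive_induct)
  case (single k d)
  show ?case
    by (cases k) (simp add: mult_single tensor_act_single uq_rep_word_add scalar_mult mult_ac)
qed (simp_all add: tensor_act_add algebra_simps)

text \<open>
  This is the induction step from \<open>h\<close> to \<open>gh\<close> for a generator \<open>g\<close>, because \<open>\<Delta>(gh) = \<Delta>(g)\<Delta>(h)\<close>.
\<close>

lemma uq_op_tensor_act:
  assumes "\<beta> \<noteq> 0"
  shows "app (uq_op \<beta> g) (tensor_act \<beta> t u v) = tensor_act \<beta> (comult_gen g * t) u v"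
proof (induction t rule: poly_mapping_additive_induct)
  case (single k c)
  have "app (uq_op \<beta> g) (star q a b) = tensor_act \<beta> (comult_gen g) a b" for a b
    by (cases g) (simp_all add: uq_op_star[OF assms] tens_def tensor_act_add tensor_act_single
        del: uq_op.simps)
  then show ?case
    by (cases k) (simp add: tensor_act_single app_smult tensor_act_mult_single)
qed (simp_all add: tensor_act_add algebra_simps)

lemma uq_rep_star:
  assumes "\<beta> \<noteq> 0"
  shows "app (uq_rep \<beta> h) (star q u v) = tensor_act \<beta> (uq_comult h) u v"
proof (induction h rule: free_alg_induct)
  case (scalar c)
  have "(scalar c :: uq_gen word \<times> uq_gen word \<Rightarrow>\<^sub>0 complex) = Poly_Mapping.single 0 c"
    by (rule scalar_def)
  then have "tensor_act \<beta> (scalar c) u v = scalar c * star q u v"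
    by (simp add: tensor_act_single)
  then show ?case
    by (simp add: uq_rep_def uq_comult_def)
next
  case (gen g p)
  then show ?case
    by (simp add: uq_rep_def uq_comult_def lscal.free_lift_mult monoid_algebra.free_lift_mult
        uq_op_tensor_act[OF assms, symmetric])
next
  case (add a b)
  then show ?case
    by (simp add: uq_rep_def uq_comult_def lscal.free_lift_add monoid_algebra.free_lift_add tensor_act_add)
qed

lemma uq_rep_one:
  "app (uq_rep \<beta> h) (Poly_Mapping.single 0 1) = scalar (uq_counit h) * Poly_Mapping.single 0 1"
proof (induction h rule: free_alg_induct)
  case (scalar c)
  show ?case by (simp add: uq_rep_def uq_counit_def)
next
  case (gen g p)
  have "app (uq_op \<beta> g) (scalar (uq_counit p) * Poly_Mapping.single 0 1)
      = scalar (uq_counit (gen g * p)) * Poly_Mapping.single 0 1"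
    unfolding app_smult uq_counit_def numbers.free_lift_mult
    by (cases g) simp_all
  with gen show ?case
    by (simp add: uq_rep_def lscal.free_lift_mult)
next
  case (add a b)
  then show ?case
    by (simp add: uq_rep_def uq_counit_def lscal.free_lift_add numbers.free_lift_add single_add del: scalar_single)
       (simp add: scalar_add distrib_right del: scalar_single)
qed

text \<open>
  The choice of a representative is harmless by \<open>uq_rep_relations\<close>; the restrictions make the
  action extensional.
\<close>

definition torus_action :: "complex \<Rightarrow> action" where
  "torus_action \<beta> = (\<lambda>h\<in>carrier (uq q). \<lambda>a\<in>carrier (torus q).
     elt (app (uq_rep \<beta> (SOME p. h = ucls q p)) (inv_into UNIV elt a)))"

lemma carrier_uq: "carrier (uq q) = range (ucls q)"
  unfolding uq_def carrier_presented_algebra by (simp add: ucls_def[abs_def])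

lemma inv_elt [simp]: "inv_into UNIV elt (elt v) = v"
  by (rule inv_f_f) (simp add: inj_def)

lemma torus_action_eq:
  assumes "\<beta> \<noteq> 0" "q\<^sup>2 \<noteq> 1"
  shows "torus_action \<beta> (ucls q p) (elt v) = elt (app (uq_rep \<beta> p) v)"
proof -
  let ?p' = "SOME p'. ucls q p = ucls q p'"
  have "ucls q p = ucls q ?p'"
    by (rule someI) (rule refl)
  then have "uq_rep \<beta> p = uq_rep \<beta> ?p'"
    unfolding uq_rep_def ucls_def
    by (rule lscal.free_lift_cong[rotated]) (use uq_rep_relations[OF assms] in \<open>simp add: uq_rep_def\<close>)
  then show ?thesis
    by (simp add: torus_action_def carrier_uq)
qed

lemma torus_action_symmetry:
  assumes \<beta>: "\<beta> \<noteq> 0" and q: "q\<^sup>2 \<noteq> 1"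
  shows "torus_action \<beta> \<in> symmetries q"
proof -
  note act = torus_action_eq[OF \<beta> q]
  have u: "ucls q a \<otimes>\<^bsub>uq q\<^esub> ucls q b = ucls q (a * b)" "ucls q a \<oplus>\<^bsub>uq q\<^esub> ucls q b = ucls q (a + b)"
    "c \<odot>\<^bsub>uq q\<^esub> ucls q a = ucls q (scalar c * a)" "\<one>\<^bsub>uq q\<^esub> = ucls q 1" for a b c
    by (simp_all add: ucls_def uq_def cls_mult cls_add cls_smult cls_1)
  have ext: "torus_action \<beta> (ucls q a) \<in> extensional (carrier (torus q))" for a
    by (simp add: torus_action_def carrier_uq)
  have endo: "torus_action \<beta> (ucls q a) \<in> linear_endos (torus q)" for a
    using ext[of a] by (auto simp: linear_endos_def PiE_def carrier_torus act app_smult)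
  have eqI: "f = g" if "f \<in> extensional (carrier (torus q))" "g \<in> extensional (carrier (torus q))"
    "\<And>v. f (elt v) = g (elt v)" for f g :: "torus_gen free_alg set \<Rightarrow> torus_gen free_alg set"
    by (rule extensionalityI[OF that(1,2)]) (use that(3) in \<open>auto simp: carrier_torus\<close>)
  have hom: "torus_action \<beta> \<in> alg_hom (uq q) (End_algebra (torus q))"
    unfolding alg_hom_def ring_hom_def
    by (auto simp: carrier_uq u End_algebra_def endo compose_def act app_smult uq_rep_def
        lscal.free_lift_simps torus_action_def[of \<beta>, THEN arg_cong, of "\<lambda>f. f \<in> extensional _"] intro!: eqI ext)
  show ?thesis
    unfolding symmetries_def
  proof (intro CollectI conjI hom allI ballI)
    fix h a b
    assume "a \<in> carrier (torus q)" "b \<in> carrier (torus q)"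
    then obtain v w where "a = elt v" "b = elt w" by (auto simp: carrier_torus)
    then show "torus_action \<beta> (ucls q h) (a \<otimes>\<^bsub>torus q\<^esub> b) =
       (\<Oplus>\<^bsub>torus q\<^esub>vw\<in>Poly_Mapping.keys (uq_comult h).
          Poly_Mapping.lookup (uq_comult h) vw \<odot>\<^bsub>torus q\<^esub>
            (torus_action \<beta> (ucls q (Poly_Mapping.single (fst vw) 1)) a \<otimes>\<^bsub>torus q\<^esub>
             torus_action \<beta> (ucls q (Poly_Mapping.single (snd vw) 1)) b))"
      by (simp add: act finsum_elt uq_rep_star[OF \<beta>] tensor_act_def)
  next
    fix h
    show "torus_action \<beta> (ucls q h) \<one>\<^bsub>torus q\<^esub> = uq_counit h \<odot>\<^bsub>torus q\<^esub> \<one>\<^bsub>torus q\<^esub>"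
      by (simp add: torus_consts act uq_rep_one)
  qed
qed

end

section \<open>Automorphisms of the quantum torus permute the monomials\<close>

lemma int_powers_of_additive:
  fixes h :: "int \<times> int \<Rightarrow> complex"
  assumes add: "\<And>i j. h (i + j) = h i * h j" and nz: "\<And>i. h i \<noteq> 0"
  shows "h (s, t) = h (1, 0) powi s * h (0, 1) powi t"
proof -
  have 1: "a s = a 1 powi s" if "\<And>m n. a (m + n) = a m * a n" "\<And>m. a m \<noteq> 0"
    for a :: "int \<Rightarrow> complex" and s
  proof (induction s rule: int_induct[where k = 0])
    case base
    show ?case using that(1)[of 0 0] that(2)[of 0] by simp
  next
    case (step1 i)
    then show ?case using that(1)[of i 1] that(2)[of 1] by (simp add: power_int_add)
  next
    case (step2 i)
    have "a i = a (i - 1) * a 1" using that(1)[of "i - 1" 1] by simp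
    with step2 show ?case using that(2)[of 1] by (simp add: power_int_diff field_simps)
  qed
  have "h (s, 0) = h (1, 0) powi s"
  proof (rule 1[of "\<lambda>m. h (m, 0)"])
    show "h (m + n, 0) = h (m, 0) * h (n, 0)" for m n
      using add[of "(m, 0)" "(n, 0)"] by simp
  qed (rule nz)
  moreover have "h (0, t) = h (0, 1) powi t"
  proof (rule 1[of "\<lambda>m. h (0, m)"])
    show "h (0, m + n) = h (0, m) * h (0, n)" for m n
      using add[of "(0, m)" "(0, n)"] by simp
  qed (rule nz)
  ultimately show ?thesis
    using add[of "(s, 0)" "(0, t)"] by simp
qed

text \<open>
  An automorphism of the quantum torus, transported to the twisted group algebra.
\<close>

locale torus_automorphism = nonzero_parameter +
  fixes \<psi> :: "lattice_vec \<Rightarrow> lattice_vec"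
  assumes \<psi>_bij: "bij \<psi>"
    and \<psi>_add: "\<psi> (u + v) = \<psi> u + \<psi> v"
    and \<psi>_smult: "\<psi> (scalar c * v) = scalar c * \<psi> v"
    and \<psi>_star: "\<psi> (star q u v) = star q (\<psi> u) (\<psi> v)"
    and \<psi>_one: "\<psi> (Poly_Mapping.single 0 1) = Poly_Mapping.single 0 1"
begin

text \<open>
  The image of the monomial with exponent \<open>i\<close> is \<open>factor i\<close> times the monomial with exponent
  \<open>expo i\<close>; existence is shown in \<open>\<psi>_single_ex\<close>.
\<close>

definition expo :: "int \<times> int \<Rightarrow> int \<times> int" where
  "expo i = (SOME k. \<exists>c. c \<noteq> 0 \<and> \<psi> (Poly_Mapping.single i 1) = Poly_Mapping.single k c)"

definition factor :: "int \<times> int \<Rightarrow> complex" where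
  "factor i = Poly_Mapping.lookup (\<psi> (Poly_Mapping.single i 1)) (expo i)"

lemma \<psi>_diff: "\<psi> (u - v) = \<psi> u - \<psi> v"
  using \<psi>_add[of "u - v" v] by simp

lemma \<psi>_eq_iff: "\<psi> u = \<psi> v \<longleftrightarrow> u = v"
  using \<psi>_bij by (auto simp: bij_def inj_eq)

lemma star_single_inverse:
  "c \<noteq> 0 \<Longrightarrow> star q (Poly_Mapping.single i c) (Poly_Mapping.single (- i) (inverse c * q powi (snd i * fst i)))
    = Poly_Mapping.single 0 1"
  by (simp add: power_int_minus field_simps)

text \<open>
  Monomials are units, and the image of a unit is a unit, hence a monomial.
\<close>

lemma \<psi>_single_ex: "\<exists>k c. c \<noteq> 0 \<and> \<psi> (Poly_Mapping.single i 1) = Poly_Mapping.single k c"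
proof -
  have "star q (\<psi> (Poly_Mapping.single i 1)) (\<psi> (Poly_Mapping.single (- i) (inverse 1 * q powi (snd i * fst i))))
      = Poly_Mapping.single 0 1"
    unfolding \<psi>_star[symmetric] by (subst star_single_inverse) (simp_all add: \<psi>_one)
  then show ?thesis
    by (rule right_invertible_single) auto
qed

lemma \<psi>_single: "\<psi> (Poly_Mapping.single i 1) = Poly_Mapping.single (expo i) (factor i)"
  and factor_nonzero [simp]: "factor i \<noteq> 0"
proof -
  have "\<exists>c. c \<noteq> 0 \<and> \<psi> (Poly_Mapping.single i 1) = Poly_Mapping.single (expo i) c"
    unfolding expo_def by (rule someI_ex) (rule \<psi>_single_ex)
  then show "\<psi> (Poly_Mapping.single i 1) = Poly_Mapping.single (expo i) (factor i)" "factor i \<noteq> 0"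
    by (auto simp: factor_def)
qed

lemma single_eq_single:
  "Poly_Mapping.single k c = Poly_Mapping.single l d \<Longrightarrow> c \<noteq> 0 \<Longrightarrow> k = l"
  by (metis lookup_single_eq lookup_single_not_eq)

lemma \<psi>_single_smult: "\<psi> (Poly_Mapping.single i c) = Poly_Mapping.single (expo i) (c * factor i)"
  using \<psi>_smult[of c "Poly_Mapping.single i 1"] by (simp add: \<psi>_single)

lemma expo_add: "expo (i + j) = expo i + expo j"
proof -
  have "\<psi> (star q (Poly_Mapping.single i 1) (Poly_Mapping.single j 1)) =
      Poly_Mapping.single (expo i + expo j) (factor i * factor j * q powi (snd (expo i) * fst (expo j)))"
    unfolding \<psi>_star \<psi>_single by simp
  moreover have "\<psi> (star q (Poly_Mapping.single i 1) (Poly_Mapping.single j 1)) =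
      Poly_Mapping.single (expo (i + j)) (q powi (snd i * fst j) * factor (i + j))"
    by (simp add: \<psi>_single_smult)
  ultimately have "Poly_Mapping.single (expo (i + j)) (q powi (snd i * fst j) * factor (i + j)) =
      Poly_Mapping.single (expo i + expo j) (factor i * factor j * q powi (snd (expo i) * fst (expo j)))"
    by (rule trans[OF sym, rotated])
  then show ?thesis
    by (rule single_eq_single) simp
qed

text \<open>
  For surjectivity, the preimage of a monomial is a unit as well, hence a monomial.
\<close>

lemma expo_bij: "bij expo"
proof (rule bijI)
  show "inj expo"
  proof (rule injI)
    fix i j assume "expo i = expo j"
    then have "\<psi> (Poly_Mapping.single i (factor j)) = \<psi> (Poly_Mapping.single j (factor i))"
      by (simp add: \<psi>_single_smult mult.commute)
    then show "i = j"
      unfolding \<psi>_eq_iff by (rule single_eq_single) (rule factor_nonzero)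
  qed
  show "surj expo"
  proof (rule surjI)
    fix k
    obtain v w where v: "\<psi> v = Poly_Mapping.single k 1"
      and w: "\<psi> w = Poly_Mapping.single (- k) (inverse 1 * q powi (snd k * fst k))"
      using \<psi>_bij by (metis bij_pointE)
    have "\<psi> (star q v w) = \<psi> (Poly_Mapping.single 0 1)"
      unfolding \<psi>_star v w \<psi>_one by (rule star_single_inverse) simp
    then have "star q v w = Poly_Mapping.single 0 1"
      by (simp only: \<psi>_eq_iff)
    then obtain i c where "c \<noteq> 0" "v = Poly_Mapping.single i c"
      by (rule right_invertible_single) auto
    with v have "Poly_Mapping.single (expo i) (c * factor i) = Poly_Mapping.single k 1"
      by (simp add: \<psi>_single_smult)
    then have "expo i = k"
      by (rule single_eq_single) (use \<open>c \<noteq> 0\<close> factor_nonzero in simp)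
    then show "expo (inv_into UNIV expo k) = k"
      by (intro f_inv_into_f) auto
  qed
qed

abbreviation expo_inv :: "int \<times> int \<Rightarrow> int \<times> int" where
  "expo_inv \<equiv> inv_into UNIV expo"

lemma expo_inv_simps [simp]: "expo (expo_inv k) = k" "expo_inv (expo i) = i"
  using expo_bij by (auto simp: bij_def surj_f_inv_f)

lemma expo_inv_add: "expo_inv (i + j) = expo_inv i + expo_inv j"
  by (metis expo_add expo_inv_simps)

lemma expo_inv_0: "expo_inv i = 0 \<longleftrightarrow> i = 0"
  by (metis add_cancel_right_right expo_add expo_inv_simps)

lemma \<psi>_preimage:
  "\<psi> (Poly_Mapping.single (expo_inv k) (inverse (factor (expo_inv k)))) = Poly_Mapping.single k 1"
  using factor_nonzero by (simp add: \<psi>_single_smult)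

end

context nonzero_parameter
begin

lemma torus_automorphismI:
  assumes "\<Psi> \<in> alg_aut (torus q)"
  obtains \<psi> where "torus_automorphism q \<psi>" "\<And>v. \<Psi> (elt v) = elt (\<psi> v)"
proof -
  define \<psi> where "\<psi> v = inv_into UNIV elt (\<Psi> (elt v))" for v
  have bij: "bij_betw \<Psi> (range elt) (range elt)"
    and hom: "\<Psi> \<in> ring_hom (torus q) (torus q)"
    and lin: "\<And>c v. \<Psi> (c \<odot>\<^bsub>torus q\<^esub> elt v) = c \<odot>\<^bsub>torus q\<^esub> \<Psi> (elt v)"
    using assms by (auto simp: alg_aut_def alg_hom_def carrier_torus)
  have \<Psi>: "\<Psi> (elt v) = elt (\<psi> v)" for v
    unfolding \<psi>_def by (rule f_inv_into_f[symmetric]) (use bij in \<open>unfold bij_betw_def, blast\<close>)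
  have "torus_automorphism q \<psi>"
  proof (unfold_locales)
    show "bij \<psi>"
    proof (rule bijI)
      show "inj \<psi>"
      proof (rule injI)
        fix u v assume "\<psi> u = \<psi> v"
        then have "\<Psi> (elt u) = \<Psi> (elt v)" by (simp add: \<Psi>)
        then show "u = v" using bij by (auto simp: bij_betw_def inj_on_def)
      qed
      show "surj \<psi>"
      proof (rule surjI)
        fix w
        have "elt w \<in> \<Psi> ` range elt" using bij by (auto simp: bij_betw_def)
        then have "w \<in> range \<psi>" by (auto simp: \<Psi>)
        then show "\<psi> (inv_into UNIV \<psi> w) = w" by (rule f_inv_into_f)
      qed
    qed
    show "\<psi> (u + v) = \<psi> u + \<psi> v" "\<psi> (star q u v) = star q (\<psi> u) (\<psi> v)" for u v
      using ring_hom_add[OF hom, of "elt u" "elt v"] ring_hom_mult[OF hom, of "elt u" "elt v"]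
      by (simp_all add: \<Psi>)
    show "\<psi> (scalar c * v) = scalar c * \<psi> v" for c v
      using lin[of c v] by (simp add: \<Psi>)
    show "\<psi> (Poly_Mapping.single 0 1) = Poly_Mapping.single 0 1"
      using ring_hom_one[OF hom] by (simp add: torus_consts \<Psi>)
  qed
  then show ?thesis using \<Psi> by (rule that)
qed

text \<open>
  The inverse automorphism is avoided by evaluating at \<open>\<psi> v\<close>.
\<close>

lemma isomorphic_to_torus_action:
  assumes "(torus_action \<beta>, \<pi>) \<in> iso_symmetries q" "\<beta> \<noteq> 0" "q\<^sup>2 \<noteq> 1"
  obtains \<psi> where "torus_automorphism q \<psi>"
    "\<And>p v. \<pi> (ucls q p) (elt (\<psi> v)) = elt (\<psi> (app (uq_rep \<beta> p) v))"
proof -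
  obtain \<Psi> where \<Psi>: "\<Psi> \<in> alg_aut (torus q)"
    and conj: "\<And>h a. h \<in> carrier (uq q) \<Longrightarrow> a \<in> carrier (torus q) \<Longrightarrow>
      \<Psi> (torus_action \<beta> h (inv_into (carrier (torus q)) \<Psi> a)) = \<pi> h a"
    using assms(1) by (auto simp: iso_symmetries_def)
  obtain \<psi> where \<psi>: "torus_automorphism q \<psi>" "\<And>v. \<Psi> (elt v) = elt (\<psi> v)"
    using torus_automorphismI[OF \<Psi>] by blast
  have "inj_on \<Psi> (carrier (torus q))"
    using \<Psi> by (auto simp: alg_aut_def bij_betw_def)
  then have "inv_into (carrier (torus q)) \<Psi> (elt (\<psi> v)) = elt v" for v
    unfolding \<psi>(2)[symmetric] by (rule inv_into_f_f) simp
  then have "\<pi> (ucls q p) (elt (\<psi> v)) = elt (\<psi> (app (uq_rep \<beta> p) v))" for p v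
    using conj[of "ucls q p" "elt (\<psi> v)"] by (simp add: carrier_uq torus_action_eq[OF assms(2,3)] \<psi>(2))
  with \<psi>(1) show ?thesis by (rule that)
qed

section \<open>The isomorphism classes\<close>

text \<open>
  Multiplicative independence of \<open>q\<^sup>2\<close> and \<open>\<beta>\<close>.
\<close>

definition independent :: "complex \<Rightarrow> bool" where
  "independent \<beta> \<longleftrightarrow> (\<forall>i. weight \<beta> i = 1 \<longrightarrow> i = 0)"

lemma uq_rep_gen [simp]: "uq_rep \<beta> (gen g) = uq_op \<beta> g"
  by (simp add: uq_rep_def)

text \<open>
  With \<open>\<psi> x = \<gamma>x\<^sup>uy\<^sup>v\<close>, conjugation turns \<open>e(a) = x k(a) - a x\<close> into
  \<open>e'(a) = \<gamma>x\<^sup>uy\<^sup>v k'(a) - a \<gamma>x\<^sup>uy\<^sup>v\<close>, and likewise for \<open>f\<close>, while \<open>k'\<close> multiplies a monomial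
  by the weight of its preimage.
\<close>

lemma generic_of_isomorphic:
  assumes iso: "(torus_action \<beta>, \<pi>) \<in> iso_symmetries q"
    and \<beta>: "\<beta> \<noteq> 0" "independent \<beta>" and q: "q\<^sup>2 \<noteq> 1"
  shows "\<pi> \<in> generic_symmetries q"
proof -
  obtain \<psi> where "torus_automorphism q \<psi>"
    and \<pi>: "\<And>p v. \<pi> (ucls q p) (elt (\<psi> v)) = elt (\<psi> (app (uq_rep \<beta> p) v))"
    using isomorphic_to_torus_action[OF iso \<beta>(1) q] by blast
  interpret torus_automorphism q \<psi> by fact
  define h where "h i = weight \<beta> (expo_inv i)" for i
  define \<alpha>' where "\<alpha>' = h (1, 0)"
  define \<beta>' where "\<beta>' = h (0, 1)"
  obtain u v where uv: "expo (1, 0) = (u, v)" by (cases "expo (1, 0)")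
  define \<gamma> where "\<gamma> = factor (1, 0)"
  define \<delta> where "\<delta> = factor (- 1, 0)"
  have h: "h (s, t) = \<alpha>' powi s * \<beta>' powi t" for s t
    unfolding \<alpha>'_def \<beta>'_def
    by (rule int_powers_of_additive) (simp_all add: h_def expo_inv_add weight_add \<beta>(1))
  have nz: "\<alpha>' \<noteq> 0" "\<beta>' \<noteq> 0" "\<gamma> \<noteq> 0" "1 - q\<^sup>2 \<noteq> 0"
    using \<beta>(1) q factor_nonzero by (simp_all add: \<alpha>'_def \<beta>'_def h_def \<gamma>_def)
  have uv': "expo (- 1, 0) = (- u, - v)"
    using expo_add[of "(1, 0)" "(- 1, 0)"] expo_add[of 0 0] uv
    by (cases "expo (- 1, 0)") (simp add: zero_prod_def)
  have x: "\<psi> (Poly_Mapping.single (1, 0) 1) = Poly_Mapping.single (u, v) \<gamma>"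
    "\<psi> (Poly_Mapping.single (- 1, 0) 1) = Poly_Mapping.single (- u, - v) \<delta>"
    by (simp_all add: \<psi>_single uv uv' \<gamma>_def \<delta>_def)
  \<comment> \<open>\<open>\<delta>\<close> is determined by \<open>\<psi>(x) \<psi>(x\<inverse>) = 1\<close>, where reordering costs \<open>q\<^sup>-\<^sup>u\<^sup>v\<close>.\<close>
  have "star q (Poly_Mapping.single (u, v) \<gamma>) (Poly_Mapping.single (- u, - v) \<delta>) = Poly_Mapping.single 0 1"
    unfolding x[symmetric] \<psi>_star[symmetric] by (simp add: \<psi>_one zero_prod_def[symmetric])
  then have "\<gamma> * \<delta> * q powi (- (u * v)) = 1"
    by (simp add: zero_prod_def[symmetric] mult.commute[of v u])
       (metis inj_single injD)
  then have \<delta>: "\<delta> = q powi (u * v) / \<gamma>"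
    using nz by (simp add: power_int_minus field_simps)
  let ?p = "\<lambda>j. Poly_Mapping.single (expo_inv j) (inverse (factor (expo_inv j)))"
  have K: "\<psi> (app (uq_op \<beta> K) (?p j)) = Poly_Mapping.single j (h j)"
    and K': "\<psi> (app (uq_op \<beta> K') (?p j)) = Poly_Mapping.single j (inverse (h j))" for j
    by (simp_all add: \<psi>_single_smult h_def mult.assoc)
  have \<pi>K: "\<pi> (ucls q (gen K)) (elt (Poly_Mapping.single j 1)) = elt (Poly_Mapping.single j (h j))" for j
    unfolding \<psi>_preimage[symmetric] \<pi> by (simp only: uq_rep_gen K \<psi>_preimage)
  have \<pi>E: "\<pi> (ucls q (gen E)) (elt (Poly_Mapping.single j 1)) =
      elt (star q (Poly_Mapping.single (u, v) \<gamma>) (Poly_Mapping.single j (h j))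
         - star q (Poly_Mapping.single j 1) (Poly_Mapping.single (u, v) \<gamma>))" for j
    using \<pi>[of "gen E" "?p j"]
    by (simp only: \<psi>_preimage uq_rep_gen uq_op_E_eq \<psi>_diff \<psi>_star K x)
  have \<pi>F: "\<pi> (ucls q (gen F)) (elt (Poly_Mapping.single j 1)) = elt (scalar f_coeff *
        (star q (Poly_Mapping.single j (inverse (h j))) (Poly_Mapping.single (- u, - v) \<delta>)
         - star q (Poly_Mapping.single (- u, - v) \<delta>) (Poly_Mapping.single j 1)))" for j
    using \<pi>[of "gen F" "?p j"]
    by (simp only: \<psi>_preimage uq_rep_gen uq_op_F_eq \<psi>_diff \<psi>_star \<psi>_smult K' x)
  \<comment> \<open>The parameter of the generic family is forced by comparing the coefficients of \<open>e'\<close>.\<close>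
  define a where "a = - \<gamma> * (1 - q\<^sup>2)\<^sup>2 / q powi (u * v + 3)"
  have a: "a * q powi (u * v + 3) / (1 - q\<^sup>2)\<^sup>2 = - \<gamma>" "- 1 / a = f_coeff * \<delta>" "a \<noteq> 0"
    using nz by (auto simp: a_def f_coeff_def \<delta> power_int_add field_simps)
  have "generic_formulas q \<alpha>' \<beta>' a u v \<pi>"
  proof -
    have aE: "a * q powi (u * v + 3) * (z / (1 - q\<^sup>2)\<^sup>2) = - \<gamma> * z" for z
      unfolding a(1)[symmetric] by simp
    have aF: "- (z / a) = f_coeff * \<delta> * z" for z
      unfolding a(2)[symmetric] by simp
    have h': "h (1, 0) = \<alpha>'" "h (0, 1) = \<beta>'"
      by (simp_all add: \<alpha>'_def \<beta>'_def)
    show ?thesis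
      unfolding generic_formulas_def aE aF torus_mon_elt torus_consts \<pi>K \<pi>E \<pi>F
      by (simp add: h' single_diff[symmetric] algebra_simps)
  qed
  \<comment> \<open>The monomial \<open>x\<^sup>uy\<^sup>v\<close> comes from \<open>x\<close>, whose weight is \<open>q\<^sup>2\<close>.\<close>
  moreover have "\<alpha>' powi u * \<beta>' powi v = q\<^sup>2"
    using h[of u v] expo_inv_simps(2)[of "(1, 0)"] uv by (simp add: h_def)
  moreover have "\<alpha>' powi m * \<beta>' powi n \<noteq> 1" if "(m, n) \<noteq> (0, 0)" for m n
  proof -
    have "expo_inv (m, n) \<noteq> 0"
      using that expo_inv_0[of "(m, n)"] by (simp only: zero_prod_def not_False_eq_True)
    then show ?thesis
      using \<beta>(2) unfolding h[symmetric] independent_def h_def by blast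
  qed
  ultimately show ?thesis
    using iso nz(1,2) a(3) unfolding generic_symmetries_def iso_symmetries_def by blast
qed

text \<open>
  The preimage of \<open>y\<close> is a monomial, so the eigenvalue \<open>\<beta>'\<close> of \<open>k\<close> at \<open>y\<close> is the weight of a
  monomial for \<open>\<beta>\<close>.
\<close>

lemma isomorphic_weights:
  assumes "(torus_action \<beta>, torus_action \<beta>') \<in> iso_symmetries q" "\<beta> \<noteq> 0" "\<beta>' \<noteq> 0" "q\<^sup>2 \<noteq> 1"
  shows "\<beta>' \<in> range (weight \<beta>)"
proof -
  obtain \<psi> where "torus_automorphism q \<psi>"
    and \<pi>: "\<And>p v. torus_action \<beta>' (ucls q p) (elt (\<psi> v)) = elt (\<psi> (app (uq_rep \<beta> p) v))"
    using isomorphic_to_torus_action[OF assms(1,2,4)] by blast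
  interpret torus_automorphism q \<psi> by fact
  let ?i = "expo_inv (0, 1)"
  have "app (uq_op \<beta>' K) (\<psi> (Poly_Mapping.single ?i (inverse (factor ?i))))
      = \<psi> (app (uq_op \<beta> K) (Poly_Mapping.single ?i (inverse (factor ?i))))"
    using \<pi>[of "gen K" "Poly_Mapping.single ?i (inverse (factor ?i))"]
    unfolding torus_action_eq[OF assms(3,4)] elt_eq_iff uq_rep_gen .
  then have "Poly_Mapping.single (0 :: int, 1 :: int) \<beta>' = Poly_Mapping.single (0, 1) (weight \<beta> ?i)"
    unfolding \<psi>_preimage by (simp add: \<psi>_single_smult mult.assoc)
  then show ?thesis
    by (metis inj_single injD rangeI)
qed

lemma iso_symmetries_refl:
  assumes "\<pi> \<in> symmetries q"
  shows "(\<pi>, \<pi>) \<in> iso_symmetries q"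
proof -
  let ?T = "carrier (torus q)"
  let ?id = "\<lambda>a\<in>?T. a"
  interpret ring "torus q" by (rule ring_torus)
  have bij: "bij_betw ?id ?T ?T"
    by (rule bij_betwI[of _ _ _ ?id]) auto
  have "?id \<in> alg_aut (torus q)"
    using bij by (auto simp: alg_aut_def alg_hom_def ring_hom_def carrier_torus torus_consts)
  moreover have "?id (\<pi> h (inv_into ?T ?id a)) = \<pi> h a"
    if "h \<in> carrier (uq q)" "a \<in> ?T" for h a
  proof -
    have "inv_into ?T ?id a = a"
      using that(2) bij by (metis bij_betw_imp_inj_on inv_into_f_eq restrict_apply')
    moreover have "\<pi> h a \<in> ?T"
      using assms that
      by (auto simp: symmetries_def alg_hom_def ring_hom_def End_algebra_def linear_endos_def)
    ultimately show ?thesis by simp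
  qed
  ultimately show ?thesis
    using assms unfolding iso_symmetries_def by blast
qed

end

text \<open>
  A relation \<open>q\<^sup>2\<^sup>m\<beta>\<^sup>n = 1\<close> with \<open>n \<noteq> 0\<close> has finitely many solutions \<open>\<beta>\<close>, and there is none
  with \<open>n = 0\<close> and \<open>m \<noteq> 0\<close> because \<open>q\<close> is not a root of unity.
\<close>

lemma (in nonzero_parameter) uncountable_independent:
  assumes "\<forall>n::nat. n > 0 \<longrightarrow> q ^ n \<noteq> 1"
  shows "uncountable {\<beta>. \<beta> \<noteq> 0 \<and> independent \<beta>}"
proof
  have root: "q powi m \<noteq> 1" if "m \<noteq> 0" for m
  proof (cases "m > 0")
    case True
    then show ?thesis using assms by (simp add: power_int_def)
  next
    case False
    then have "q ^ nat (- m) \<noteq> 1" using assms that by simp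
    then show ?thesis using False that by (simp add: power_int_def power_inverse)
  qed
  let ?bad = "\<lambda>i. {\<beta>. snd i \<noteq> 0 \<and> \<beta> \<noteq> 0 \<and> weight \<beta> i = 1}"
  have "finite (?bad (m, n))" for m n
  proof (cases "n = 0")
    case False
    let ?c = "q powi (- (2 * m))"
    have "?bad (m, n) \<subseteq> {z. z ^ nat \<bar>n\<bar> = ?c} \<union> {z. z ^ nat \<bar>n\<bar> = inverse ?c}"
      using False
      by (cases "n > 0") (auto simp: weight_def power_int_def[of _ n] power_int_minus field_simps)
    moreover have "finite \<dots>"
      using False by (intro finite_UnI finite_nth_roots) simp_all
    ultimately show ?thesis by (rule finite_subset)
  qed simp
  then have "countable (\<Union>i. ?bad i)"
    by (intro countable_UN countableI_type countable_finite) auto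
  moreover assume "countable {\<beta>. \<beta> \<noteq> 0 \<and> independent \<beta>}"
  moreover have "UNIV \<subseteq> {0} \<union> (\<Union>i. ?bad i) \<union> {\<beta>. \<beta> \<noteq> 0 \<and> independent \<beta>}"
  proof
    fix \<beta> :: complex
    have "\<beta> \<in> (\<Union>i. ?bad i)" if "\<beta> \<noteq> 0" "\<not> independent \<beta>"
    proof -
      obtain i where i: "weight \<beta> i = 1" "i \<noteq> 0"
        using \<open>\<not> independent \<beta>\<close> by (auto simp only: independent_def)
      have "snd i \<noteq> 0"
      proof
        assume "snd i = 0"
        with i have "fst i \<noteq> 0" "q powi (2 * fst i) = 1"
          by (auto simp: weight_def prod_eq_iff)
        then show False using root[of "2 * fst i"] by simp
      qed
      with i that show ?thesis by blast
    qed
    then show "\<beta> \<in> {0} \<union> (\<Union>i. ?bad i) \<union> {\<beta>. \<beta> \<noteq> 0 \<and> independent \<beta>}"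
      by blast
  qed
  ultimately have "countable (UNIV :: complex set)"
    by (meson countable_Un countable_finite countable_subset finite.emptyI finite_insert)
  then show False
    using uncountable_UNIV_complex by contradiction
qed

lemma countable_of_countable_fibres:
  assumes "countable (f ` B)" and "\<And>b. b \<in> B \<Longrightarrow> countable {b' \<in> B. f b' = f b}"
  shows "countable B"
proof -
  have "countable (\<Union>c\<in>f ` B. {b \<in> B. f b = c})"
    by (rule countable_UN) (use assms in auto)
  moreover have "(\<Union>c\<in>f ` B. {b \<in> B. f b = c}) = B"
    by blast
  ultimately show ?thesis by simp
qed

theorem proposition3p6:
  fixes q :: complex
  assumes "q \<noteq> 0" and "\<forall>n::nat. n > 0 \<longrightarrow> q ^ n \<noteq> 1"
  shows "uncountable {C \<in> symmetries q // iso_symmetries q. C \<subseteq> generic_symmetries q}"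
proof
  interpret nonzero_parameter q by standard (rule assms)
  have q2: "q\<^sup>2 \<noteq> 1" using assms(2) by simp
  let ?B = "{\<beta>. \<beta> \<noteq> 0 \<and> independent \<beta>}"
  let ?cl = "\<lambda>\<beta>. iso_symmetries q `` {torus_action \<beta>}"
  assume "countable {C \<in> symmetries q // iso_symmetries q. C \<subseteq> generic_symmetries q}"
  moreover have "?cl ` ?B \<subseteq> {C \<in> symmetries q // iso_symmetries q. C \<subseteq> generic_symmetries q}"
    using torus_action_symmetry[OF _ q2] generic_of_isomorphic[OF _ _ _ q2]
    by (auto intro: quotientI)
  ultimately have "countable (?cl ` ?B)"
    by (rule countable_subset[rotated])
  moreover have "countable {\<beta>' \<in> ?B. ?cl \<beta>' = ?cl \<beta>}" if \<beta>: "\<beta> \<in> ?B" for \<beta>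
  proof (rule countable_subset)
    show "{\<beta>' \<in> ?B. ?cl \<beta>' = ?cl \<beta>} \<subseteq> range (weight \<beta>)"
    proof
      fix \<beta>' assume "\<beta>' \<in> {\<beta>' \<in> ?B. ?cl \<beta>' = ?cl \<beta>}"
      then have nz: "\<beta> \<noteq> 0" "\<beta>' \<noteq> 0" and eq: "?cl \<beta>' = ?cl \<beta>"
        using \<beta> by blast+
      have "torus_action \<beta>' \<in> ?cl \<beta>'"
        using iso_symmetries_refl[OF torus_action_symmetry[OF nz(2) q2]] by simp
      then have "(torus_action \<beta>, torus_action \<beta>') \<in> iso_symmetries q"
        unfolding eq by simp
      then show "\<beta>' \<in> range (weight \<beta>)"
        using isomorphic_weights nz q2 by blast
    qed
  qed simp
  ultimately have "countable ?B"
    by (rule countable_of_countable_fibres)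
  then show False
    using uncountable_independent[OF assms(2)] by contradiction
qed

end
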